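(* Let $(M,g)$, $M=\mathbb{R}\times S$, be an SOM-spacetime with Fermat metric $F$ and associated pre-distance $d_F$. Then: (i) a nonzero vector $(\tau,v)\in TM\equiv\mathbb{R}\times TS$ is lightlike and future-directed if and only if $\tau=F(v)$; (ii) a vector $(\tau,v)\in TM\equiv\mathbb{R}\times TS$ is timelike and future-directed if and only if $\tau>F(v)$; (iii) for all $(t_0,x_0),(t_1,x_1)\in M$: (a) $(t_0,x_0)\ll(t_1,x_1)\iff d_F(x_0,x_1)<t_1-t_0$; (b) $(t_0,x_0)\le(t_1,x_1)\implies d_F(x_0,x_1)\le t_1-t_0$; (c) $I^+(t_0,x_0)=\bigcup_{s\in\mathbb{R}}\{t_0+s\}\times B_F^+(x_0,s)$; (d) $I^-(t_0,x_0)=\bigcup_{s\in\mathbb{R}}\{t_0-s\}\times B_F^-(x_0,s)$.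
   Context: An SOM-spacetime is a product $M=\mathbb{R}\times S$ ($S$ a connected smooth manifold) with the Lorentzian metric $g=-\beta\,dt\otimes dt+dt\otimes\omega+\omega\otimes dt+g_0$, where $\beta:S\to(0,\infty)$ is a smooth function, $\omega$ a one-form on $S$, $g_0$ a symmetric $(0,2)$-tensor on $S$, and $g_0(v,v)+\frac1\beta\omega(v)^2>0$ for every nonzero $v\in TS$; it is time-oriented by the timelike Killing field $\partial_t$. Its Fermat metric is $F(v)=\frac1\beta\omega(v)+\sqrt{\frac1{\beta^2}\omega(v)^2+\frac1\beta g_0(v,v)}$. The pre-distance $d_F(x_0,x_1)\in\mathbb{R}\cup\{-\infty\}$ is the infimum of $\ell_F(c)=\int F(\dot c)\,ds$ over piecewise smooth curves $c$ from $x_0$ to $x_1$ (constant curves allowed). For $r\in\mathbb{R}$, $B^+_F(x_0,r)=\{x\in S: d_F(x_0,x)<r\}$ and $B^-_F(x_0,r)=\{x\in S:d_F(x,x_0)<r\}$. $p\ll q$ means there is a future-directed timelike curve from $p$ to $q$; $p\le q$ means $p=q$ or there is a future-directed causal curve from $p$ to $q$; $I^+(p)=\{q:p\ll q\}$, $I^-(p)=\{q:q\ll p\}$. *)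

theory Defs
  imports "HOL-Analysis.Analysis"
begin

section \<open>Smooth maps between Euclidean spaces\<close>

text \<open>All iterated directional derivatives up to order \<open>k\<close> exist and are continuous; only meant
  for open \<open>U\<close>.\<close>

primrec C_k_on :: "nat \<Rightarrow> ('a::real_normed_vector \<Rightarrow> 'b::real_normed_vector) \<Rightarrow> 'a set \<Rightarrow> bool" where
  "C_k_on 0 f U \<longleftrightarrow> continuous_on U f"
| "C_k_on (Suc k) f U \<longleftrightarrow> (\<forall>x\<in>U. f differentiable (at x)) \<and>
     (\<forall>v. C_k_on k (\<lambda>x. frechet_derivative f (at x) v) U)"

definition smooth_on :: "'a::real_normed_vector set \<Rightarrow> ('a \<Rightarrow> 'b::real_normed_vector) \<Rightarrow> bool" where
  "smooth_on U f \<longleftrightarrow> (\<forall>k. C_k_on k f U)"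


section \<open>Smooth manifolds\<close>

text \<open>A manifold is a Hausdorff second countable type with an atlas modelled on a Euclidean space. A
  chart is a pair of its domain and its coordinate map; values of the map off the domain are
  irrelevant. Atlases need not be maximal.\<close>

type_synonym ('a, 'b) chart = "'a set \<times> ('a \<Rightarrow> 'b)"

definition chart_inv :: "('a, 'b) chart \<Rightarrow> 'b \<Rightarrow> 'a" where
  "chart_inv C = inv_into (fst C) (snd C)"

definition smooth_atlas ::
  "('a::{t2_space,second_countable_topology}, 'b::euclidean_space) chart set \<Rightarrow> bool" where
  "smooth_atlas A \<longleftrightarrow>
     (\<Union>C\<in>A. fst C) = UNIV \<and>
     (\<forall>C\<in>A. open (fst C) \<and> open (snd C ` fst C) \<and>
        homeomorphism (fst C) (snd C ` fst C) (snd C) (chart_inv C)) \<and>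
     (\<forall>C\<in>A. \<forall>C'\<in>A. smooth_on (snd C ` (fst C \<inter> fst C')) (snd C' \<circ> chart_inv C))"

definition smooth_fun :: "('a, 'b::euclidean_space) chart set \<Rightarrow> ('a \<Rightarrow> real) \<Rightarrow> bool" where
  "smooth_fun A f \<longleftrightarrow> (\<forall>C\<in>A. smooth_on (snd C ` fst C) (f \<circ> chart_inv C))"

text \<open>Tangent vectors are derivations of the algebra of smooth functions. A derivation is represented
  by a functional on all functions that is \<open>0\<close> on the non-smooth ones, so that equality
  of tangent vectors is equality in HOL.\<close>

type_synonym 'a tvec = "('a \<Rightarrow> real) \<Rightarrow> real"

definition tangent_space :: "('a, 'b::euclidean_space) chart set \<Rightarrow> 'a \<Rightarrow> 'a tvec set" where
  "tangent_space A x = {v.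
     (\<forall>f. \<not> smooth_fun A f \<longrightarrow> v f = 0) \<and>
     (\<forall>f g a b. smooth_fun A f \<longrightarrow> smooth_fun A g \<longrightarrow>
        v (\<lambda>y. a * f y + b * g y) = a * v f + b * v g) \<and>
     (\<forall>f g. smooth_fun A f \<longrightarrow> smooth_fun A g \<longrightarrow>
        v (\<lambda>y. f y * g y) = f x * v g + g x * v f)}"

definition zero_tvec :: "'a tvec" where
  "zero_tvec = (\<lambda>f. 0)"

text \<open>For a basis vector \<open>e\<close> this is the coordinate vector \<open>\<partial>/\<partial>x\<^sup>e\<close> at \<open>x\<close> of the chart \<open>C\<close>.\<close>

definition coord_tvec ::
  "('a, 'b::euclidean_space) chart set \<Rightarrow> ('a, 'b) chart \<Rightarrow> 'b \<Rightarrow> 'a \<Rightarrow> 'a tvec" where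
  "coord_tvec A C e x = (\<lambda>f. if smooth_fun A f
     then frechet_derivative (f \<circ> chart_inv C) (at (snd C x)) e else 0)"

definition one_form :: "('a, 'b::euclidean_space) chart set \<Rightarrow> ('a \<Rightarrow> 'a tvec \<Rightarrow> real) \<Rightarrow> bool" where
  "one_form A \<omega> \<longleftrightarrow>
     (\<forall>x. \<forall>v\<in>tangent_space A x. \<forall>w\<in>tangent_space A x. \<forall>a b.
        \<omega> x (\<lambda>f. a * v f + b * w f) = a * \<omega> x v + b * \<omega> x w) \<and>
     (\<forall>C\<in>A. \<forall>e\<in>Basis.
        smooth_on (snd C ` fst C) (\<lambda>y. \<omega> (chart_inv C y) (coord_tvec A C e (chart_inv C y))))"

definition sym_2_tensor ::
  "('a, 'b::euclidean_space) chart set \<Rightarrow> ('a \<Rightarrow> 'a tvec \<Rightarrow> 'a tvec \<Rightarrow> real) \<Rightarrow> bool" where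
  "sym_2_tensor A h \<longleftrightarrow>
     (\<forall>x. \<forall>v\<in>tangent_space A x. \<forall>w\<in>tangent_space A x. h x v w = h x w v) \<and>
     (\<forall>x. \<forall>u\<in>tangent_space A x. \<forall>v\<in>tangent_space A x. \<forall>w\<in>tangent_space A x. \<forall>a b.
        h x (\<lambda>f. a * v f + b * w f) u = a * h x v u + b * h x w u) \<and>
     (\<forall>C\<in>A. \<forall>d\<in>Basis. \<forall>e\<in>Basis.
        smooth_on (snd C ` fst C) (\<lambda>y. h (chart_inv C y)
          (coord_tvec A C d (chart_inv C y)) (coord_tvec A C e (chart_inv C y))))"


section \<open>Curves\<close>

definition smooth_curve_open ::
  "('a::topological_space, 'b::euclidean_space) chart set \<Rightarrow> real set \<Rightarrow> (real \<Rightarrow> 'a) \<Rightarrow> bool" where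
  "smooth_curve_open A U c \<longleftrightarrow> open U \<and> continuous_on U c \<and>
     (\<forall>C\<in>A. smooth_on (U \<inter> c -` fst C) (snd C \<circ> c))"

text \<open>A curve on a closed interval is smooth if it extends smoothly to an open neighbourhood.\<close>

definition smooth_curve ::
  "('a::topological_space, 'b::euclidean_space) chart set \<Rightarrow> real set \<Rightarrow> (real \<Rightarrow> 'a) \<Rightarrow> bool" where
  "smooth_curve A I c \<longleftrightarrow> (\<exists>U c'. I \<subseteq> U \<and> smooth_curve_open A U c' \<and> (\<forall>s\<in>I. c' s = c s))"

definition subdivision :: "real \<Rightarrow> real \<Rightarrow> nat \<Rightarrow> (nat \<Rightarrow> real) \<Rightarrow> bool" where
  "subdivision a b n p \<longleftrightarrow> 0 < n \<and> p 0 = a \<and> p n = b \<and> (\<forall>i<n. p i < p (Suc i))"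

definition piecewise_smooth ::
  "('a::topological_space, 'b::euclidean_space) chart set \<Rightarrow> real \<Rightarrow> real \<Rightarrow> (real \<Rightarrow> 'a) \<Rightarrow> bool" where
  "piecewise_smooth A a b c \<longleftrightarrow>
     (\<exists>n p. subdivision a b n p \<and> (\<forall>i<n. smooth_curve A {p i..p (Suc i)} c))"

text \<open>The derivative is taken within \<open>I\<close>, hence is one-sided at the end points of a closed interval.
  It is unspecified at parameters where the derivative does not exist.\<close>

definition velocity ::
  "('a, 'b::euclidean_space) chart set \<Rightarrow> real set \<Rightarrow> (real \<Rightarrow> 'a) \<Rightarrow> real \<Rightarrow> 'a tvec" where
  "velocity A I c s = (\<lambda>f. if smooth_fun A f
     then vector_derivative (f \<circ> c) (at s within I) else 0)"


section \<open>SOM-spacetimes\<close>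

text \<open>The spacetime is \<open>M = \<real> \<times> S\<close> with the product smooth structure. A tangent vector of \<open>M\<close> at \<open>(t, x)\<close>
  is identified with a pair \<open>(\<tau>, v)\<close> of a real number and a tangent vector \<open>v\<close> of \<open>S\<close> at \<open>x\<close>.\<close>

definition product_atlas :: "('a, 'b) chart set \<Rightarrow> (real \<times> 'a, real \<times> 'b) chart set" where
  "product_atlas A = (\<lambda>C. (UNIV \<times> fst C, map_prod id (snd C))) ` A"

definition velocity_M :: "('a, 'b::euclidean_space) chart set \<Rightarrow> real set \<Rightarrow>
    (real \<Rightarrow> real \<times> 'a) \<Rightarrow> real \<Rightarrow> real \<times> 'a tvec" where
  "velocity_M A I \<gamma> s =
     (vector_derivative (fst \<circ> \<gamma>) (at s within I), velocity A I (snd \<circ> \<gamma>) s)"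

definition som_metric :: "('a \<Rightarrow> real) \<Rightarrow> ('a \<Rightarrow> 'a tvec \<Rightarrow> real) \<Rightarrow>
    ('a \<Rightarrow> 'a tvec \<Rightarrow> 'a tvec \<Rightarrow> real) \<Rightarrow> real \<times> 'a \<Rightarrow> real \<times> 'a tvec \<Rightarrow> real \<times> 'a tvec \<Rightarrow> real" where
  "som_metric \<beta> \<omega> g0 p w w' = (let x = snd p in
     - \<beta> x * fst w * fst w' + fst w * \<omega> x (snd w') + \<omega> x (snd w) * fst w' + g0 x (snd w) (snd w'))"

text \<open>The last condition is exactly what makes \<^const>\<open>som_metric\<close> Lorentzian.\<close>

definition som_spacetime ::
  "('a::{t2_space,second_countable_topology}, 'b::euclidean_space) chart set \<Rightarrow> ('a \<Rightarrow> real) \<Rightarrow>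
    ('a \<Rightarrow> 'a tvec \<Rightarrow> real) \<Rightarrow> ('a \<Rightarrow> 'a tvec \<Rightarrow> 'a tvec \<Rightarrow> real) \<Rightarrow> bool" where
  "som_spacetime A \<beta> \<omega> g0 \<longleftrightarrow>
     smooth_atlas A \<and> connected (UNIV :: 'a set) \<and>
     smooth_fun A \<beta> \<and> (\<forall>x. \<beta> x > 0) \<and> one_form A \<omega> \<and> sym_2_tensor A g0 \<and>
     (\<forall>x. \<forall>v\<in>tangent_space A x. v \<noteq> zero_tvec \<longrightarrow> g0 x v v + (1 / \<beta> x) * (\<omega> x v)\<^sup>2 > 0)"

context
  fixes A :: "('a::topological_space, 'b::euclidean_space) chart set"
    and \<beta> :: "'a \<Rightarrow> real"
    and \<omega> :: "'a \<Rightarrow> 'a tvec \<Rightarrow> real"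
    and g0 :: "'a \<Rightarrow> 'a tvec \<Rightarrow> 'a tvec \<Rightarrow> real"
begin

definition timelike :: "real \<times> 'a \<Rightarrow> real \<times> 'a tvec \<Rightarrow> bool" where
  "timelike p w \<longleftrightarrow> som_metric \<beta> \<omega> g0 p w w < 0"

definition lightlike :: "real \<times> 'a \<Rightarrow> real \<times> 'a tvec \<Rightarrow> bool" where
  "lightlike p w \<longleftrightarrow> w \<noteq> (0, zero_tvec) \<and> som_metric \<beta> \<omega> g0 p w w = 0"

definition causal :: "real \<times> 'a \<Rightarrow> real \<times> 'a tvec \<Rightarrow> bool" where
  "causal p w \<longleftrightarrow> timelike p w \<or> lightlike p w"

text \<open>The time orientation is given by \<open>\<partial>\<^sub>t = (1, 0)\<close>.\<close>

definition future_directed :: "real \<times> 'a \<Rightarrow> real \<times> 'a tvec \<Rightarrow> bool" where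
  "future_directed p w \<longleftrightarrow> causal p w \<and> som_metric \<beta> \<omega> g0 p w (1, zero_tvec) < 0"

text \<open>At break points both one-sided velocities are required to satisfy the condition.\<close>

definition fd_timelike_curve :: "real \<Rightarrow> real \<Rightarrow> (real \<Rightarrow> real \<times> 'a) \<Rightarrow> bool" where
  "fd_timelike_curve a b \<gamma> \<longleftrightarrow> (\<exists>n p. subdivision a b n p \<and>
     (\<forall>i<n. smooth_curve (product_atlas A) {p i..p (Suc i)} \<gamma> \<and>
        (\<forall>s\<in>{p i..p (Suc i)}. let w = velocity_M A {p i..p (Suc i)} \<gamma> s in
           timelike (\<gamma> s) w \<and> future_directed (\<gamma> s) w)))"

definition fd_causal_curve :: "real \<Rightarrow> real \<Rightarrow> (real \<Rightarrow> real \<times> 'a) \<Rightarrow> bool" where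
  "fd_causal_curve a b \<gamma> \<longleftrightarrow> (\<exists>n p. subdivision a b n p \<and>
     (\<forall>i<n. smooth_curve (product_atlas A) {p i..p (Suc i)} \<gamma> \<and>
        (\<forall>s\<in>{p i..p (Suc i)}. let w = velocity_M A {p i..p (Suc i)} \<gamma> s in
           causal (\<gamma> s) w \<and> future_directed (\<gamma> s) w)))"

definition chron_le :: "real \<times> 'a \<Rightarrow> real \<times> 'a \<Rightarrow> bool" where
  "chron_le p q \<longleftrightarrow> (\<exists>a b \<gamma>. fd_timelike_curve a b \<gamma> \<and> \<gamma> a = p \<and> \<gamma> b = q)"

definition causal_le :: "real \<times> 'a \<Rightarrow> real \<times> 'a \<Rightarrow> bool" where
  "causal_le p q \<longleftrightarrow> p = q \<or> (\<exists>a b \<gamma>. fd_causal_curve a b \<gamma> \<and> \<gamma> a = p \<and> \<gamma> b = q)"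

definition chron_future :: "real \<times> 'a \<Rightarrow> (real \<times> 'a) set" where
  "chron_future p = {q. chron_le p q}"

definition chron_past :: "real \<times> 'a \<Rightarrow> (real \<times> 'a) set" where
  "chron_past p = {q. chron_le q p}"

definition fermat :: "'a \<Rightarrow> 'a tvec \<Rightarrow> real" where
  "fermat x v = (1 / \<beta> x) * \<omega> x v +
     sqrt ((1 / (\<beta> x)\<^sup>2) * (\<omega> x v)\<^sup>2 + (1 / \<beta> x) * g0 x v v)"

text \<open>The finitely many break points, where the velocity is unspecified, do not affect the integral.\<close>

definition fermat_length :: "real \<Rightarrow> real \<Rightarrow> (real \<Rightarrow> 'a) \<Rightarrow> real" where
  "fermat_length a b c = integral {a..b} (\<lambda>s. fermat (c s) (velocity A {a..b} c s))"

definition fermat_dist :: "'a \<Rightarrow> 'a \<Rightarrow> ereal" where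
  "fermat_dist x0 x1 = Inf {ereal (fermat_length a b c) | a b c.
     piecewise_smooth A a b c \<and> c a = x0 \<and> c b = x1}"

definition ball_fwd :: "'a \<Rightarrow> real \<Rightarrow> 'a set" where
  "ball_fwd x0 r = {x. fermat_dist x0 x < ereal r}"

definition ball_bwd :: "'a \<Rightarrow> real \<Rightarrow> 'a set" where
  "ball_bwd x0 r = {x. fermat_dist x x0 < ereal r}"

end

end

theory Submission
  imports Defs
begin

text \<open>
  The causal type of a vector \<open>(\<tau>, v)\<close> over \<open>x\<close> is decided by the quadratic polynomial
  \<open>-\<beta> \<tau>\<^sup>2 + 2 \<omega>(v) \<tau> + g\<^sub>0(v, v)\<close> in \<open>\<tau>\<close>. Its larger root is \<open>F(v)\<close>, and the future-directed vectors
  lie to the right of the midpoint \<open>\<omega>(v)/\<beta>\<close> of the roots. Hence among the future-directed vectors the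
  lightlike ones have \<open>\<tau> = F(v)\<close> and the timelike ones \<open>\<tau> > F(v)\<close>
  (\<open>future_lightlike_iff\<close>, \<open>future_timelike_iff\<close>).

  A curve \<open>\<gamma> = (t, c)\<close> is therefore timelike and future-directed if and only if \<open>t' > F(c')\<close>, and the
  causal ones satisfy \<open>t' \<ge> F(c')\<close>. Integration bounds \<open>\<ell>\<^sub>F(c)\<close> by the elapsed time, strictly for a
  timelike curve because the functions involved are continuous on each closed piece
  (\<open>fermat_length_compare\<close>). This continuity (\<open>continuous_on_fermat_velocity\<close>) is a chart computation:
  by the chain rule the velocity is a combination of coordinate vectors whose coefficients are the
  derivatives of the coordinates of \<open>c\<close>.

  Conversely, let \<open>\<ell>\<^sub>F(c) < T\<close>. A time function with derivative exactly \<open>F(c')\<close> gives no timelike lift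
  of \<open>c\<close>, and it need not be smooth on the pieces, since \<open>F\<close> is not smooth at zero vectors. The slack
  \<open>T - \<ell>\<^sub>F(c)\<close> leaves room for a polynomial strictly above \<open>F(c')\<close> on each piece, with integrals that
  add up to \<open>T\<close> (\<open>smooth_primitive_above\<close>). Its primitives, glued at the break points, lift \<open>c\<close> to a
  timelike curve with elapsed time \<open>T\<close> (\<open>timelike_curve_over\<close>). The statements on chronological
  futures and pasts rephrase the resulting characterization of the chronological relation.
\<close>

section \<open>Calculus of iterated directional derivatives\<close>

lemma C_k_on_cong:
  assumes "open U" "\<And>x. x \<in> U \<Longrightarrow> f x = g x" "C_k_on k f U"
  shows "C_k_on k g U"
  using assms(2,3)
proof (induction k arbitrary: f g)
  case 0
  then have "continuous_on U f" by simp
  then have "continuous_on U g" by (rule continuous_on_eq) (rule 0)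
  then show ?case by simp
next
  case (Suc k)
  have g: "(g has_derivative frechet_derivative f (at x)) (at x)" if "x \<in> U" for x
  proof (rule has_derivative_transform_within_open[OF _ assms(1) that Suc.prems(1)])
    show "(f has_derivative frechet_derivative f (at x)) (at x)"
      using Suc.prems(2) that by (simp add: frechet_derivative_works[symmetric])
  qed
  have "C_k_on k (\<lambda>x. frechet_derivative g (at x) v) U" for v
  proof (rule Suc.IH)
    show "frechet_derivative f (at x) v = frechet_derivative g (at x) v" if "x \<in> U" for x
      using frechet_derivative_at[OF g[OF that]] by metis
    show "C_k_on k (\<lambda>x. frechet_derivative f (at x) v) U" using Suc.prems(2) by simp
  qed
  then show ?case using g unfolding C_k_on.simps differentiable_def by blast
qed

text \<open>Here \<open>f'\<close> is the derivative of \<open>f\<close> on \<open>U\<close> in any closed form that a rule of differentiation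
  provides, which is what makes an induction on the order of differentiability go through.\<close>

lemma C_k_on_SucI:
  assumes "open U" "\<And>x. x \<in> U \<Longrightarrow> (f has_derivative f' x) (at x)"
    and "\<And>v. C_k_on k (\<lambda>x. f' x v) U"
  shows "C_k_on (Suc k) f U"
proof -
  have "C_k_on k (\<lambda>x. frechet_derivative f (at x) v) U" for v
  proof (rule C_k_on_cong[OF assms(1) _ assms(3)])
    show "f' x v = frechet_derivative f (at x) v" if "x \<in> U" for x
      using frechet_derivative_at[OF assms(2)[OF that]] by metis
  qed
  then show ?thesis using assms(2) unfolding C_k_on.simps differentiable_def by blast
qed

lemma C_k_on_subset: "C_k_on k f U \<Longrightarrow> V \<subseteq> U \<Longrightarrow> C_k_on k f V"
proof (induction k arbitrary: f)
  case 0
  then show ?case using continuous_on_subset by auto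
next
  case (Suc k)
  then show ?case unfolding C_k_on.simps by blast
qed

lemma C_k_on_open_UN:
  assumes "\<And>i. i \<in> I \<Longrightarrow> open (V i)" "\<And>i. i \<in> I \<Longrightarrow> C_k_on k f (V i)"
  shows "C_k_on k f (\<Union>i\<in>I. V i)"
  using assms
proof (induction k arbitrary: f)
  case 0
  then show ?case by (simp add: continuous_on_open_UN)
next
  case (Suc k)
  from Suc.prems(2) have "C_k_on k (\<lambda>x. frechet_derivative f (at x) v) (\<Union>i\<in>I. V i)" for v
    by (intro Suc.IH) (auto simp: Suc.prems(1))
  with Suc.prems(2) show ?case by auto
qed

lemma C_k_on_const: "C_k_on k (\<lambda>x. c) U"
  by (induction k arbitrary: c) simp_all

lemma C_k_on_SucD:
  assumes "C_k_on (Suc k) f U"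
  shows "x \<in> U \<Longrightarrow> (f has_derivative frechet_derivative f (at x)) (at x)"
    and "C_k_on k (\<lambda>x. frechet_derivative f (at x) v) U"
  using assms by (simp_all add: frechet_derivative_works[symmetric])

lemma C_k_on_linear:
  assumes "open U" "bounded_linear L" "C_k_on k f U"
  shows "C_k_on k (\<lambda>x. L (f x)) U"
  using assms(3)
proof (induction k arbitrary: f)
  case 0
  then show ?case using bounded_linear.continuous_on[OF assms(2)] by simp
next
  case (Suc k)
  show ?case
  proof (rule C_k_on_SucI[OF assms(1)])
    show "((\<lambda>x. L (f x)) has_derivative (\<lambda>v. L (frechet_derivative f (at x) v))) (at x)"
      if "x \<in> U" for x
      by (rule bounded_linear.has_derivative[OF assms(2) C_k_on_SucD(1)[OF Suc.prems that]])
    show "C_k_on k (\<lambda>x. L (frechet_derivative f (at x) v)) U" for v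
      by (rule Suc.IH[OF C_k_on_SucD(2)[OF Suc.prems]])
  qed
qed

lemma C_k_on_Pair:
  assumes "open U" "C_k_on k f U" "C_k_on k g U"
  shows "C_k_on k (\<lambda>x. (f x, g x)) U"
  using assms(2,3)
proof (induction k arbitrary: f g)
  case 0
  then show ?case by (simp add: continuous_on_Pair)
next
  case (Suc k)
  show ?case
  proof (rule C_k_on_SucI[OF assms(1)])
    show "((\<lambda>x. (f x, g x)) has_derivative
        (\<lambda>v. (frechet_derivative f (at x) v, frechet_derivative g (at x) v))) (at x)" if "x \<in> U" for x
      using has_derivative_Pair[OF C_k_on_SucD(1)[OF Suc.prems(1) that] C_k_on_SucD(1)[OF Suc.prems(2) that]] .
    show "C_k_on k (\<lambda>x. (frechet_derivative f (at x) v, frechet_derivative g (at x) v)) U" for v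
      by (intro Suc.IH C_k_on_SucD(2) Suc.prems)
  qed
qed

lemma C_k_on_add:
  assumes "open U" "C_k_on k f U" "C_k_on k g U"
  shows "C_k_on k (\<lambda>x. f x + g x) U"
proof -
  have "bounded_linear (\<lambda>p. fst p + snd p)"
    by (intro bounded_linear_add bounded_linear_fst bounded_linear_snd)
  from C_k_on_linear[OF assms(1) this C_k_on_Pair[OF assms]] show ?thesis by simp
qed

lemma smooth_onD:
  assumes "smooth_on U f"
  shows smooth_on_imp_continuous_on: "continuous_on U f"
    and smooth_on_imp_differentiable: "x \<in> U \<Longrightarrow> f differentiable (at x)"
    and smooth_on_frechet_derivative: "smooth_on U (\<lambda>x. frechet_derivative f (at x) v)"
proof -
  show "continuous_on U f" using assms C_k_on.simps(1) unfolding smooth_on_def by blast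
  show "f differentiable (at x)" if "x \<in> U"
    using assms that C_k_on.simps(2)[of 0] unfolding smooth_on_def by blast
  show "smooth_on U (\<lambda>x. frechet_derivative f (at x) v)"
    using assms C_k_on.simps(2) unfolding smooth_on_def by blast
qed

lemma smooth_on_subset: "smooth_on U f \<Longrightarrow> V \<subseteq> U \<Longrightarrow> smooth_on V f"
  unfolding smooth_on_def by (blast intro: C_k_on_subset)

lemma smooth_on_const: "smooth_on U (\<lambda>x. c)"
  by (simp add: smooth_on_def C_k_on_const)

lemma smooth_on_linear:
  "open U \<Longrightarrow> bounded_linear L \<Longrightarrow> smooth_on U f \<Longrightarrow> smooth_on U (\<lambda>x. L (f x))"
  by (simp add: smooth_on_def C_k_on_linear)

lemma smooth_on_Pair:
  "open U \<Longrightarrow> smooth_on U f \<Longrightarrow> smooth_on U g \<Longrightarrow> smooth_on U (\<lambda>x. (f x, g x))"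
  by (simp add: smooth_on_def C_k_on_Pair)

lemma smooth_on_add:
  "open U \<Longrightarrow> smooth_on U f \<Longrightarrow> smooth_on U g \<Longrightarrow> smooth_on U (\<lambda>x. f x + g x)"
  by (simp add: smooth_on_def C_k_on_add)

lemma smooth_on_mult:
  fixes f g :: "'a::real_normed_vector \<Rightarrow> real"
  assumes "open U" "smooth_on U f" "smooth_on U g"
  shows "smooth_on U (\<lambda>x. f x * g x)"
proof -
  have "C_k_on k (\<lambda>x. f x * g x) U" for k
    using assms(2,3)
  proof (induction k arbitrary: f g)
    case 0
    then show ?case by (simp add: continuous_on_mult smooth_on_imp_continuous_on)
  next
    case (Suc k)
    show ?case
    proof (rule C_k_on_SucI[OF assms(1)])
      show "((\<lambda>x. f x * g x) has_derivative (\<lambda>v. f x * frechet_derivative g (at x) v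
          + frechet_derivative f (at x) v * g x)) (at x)" if "x \<in> U" for x
        using Suc.prems that
        by (intro has_derivative_mult) (simp_all add: smooth_on_imp_differentiable frechet_derivative_works[symmetric])
      show "C_k_on k (\<lambda>x. f x * frechet_derivative g (at x) v
          + frechet_derivative f (at x) v * g x) U" for v
        by (intro C_k_on_add[OF assms(1)] Suc.IH smooth_on_frechet_derivative Suc.prems)
    qed
  qed
  then show ?thesis by (simp add: smooth_on_def)
qed

lemma smooth_on_bounded_linear:
  assumes "bounded_linear f"
  shows "smooth_on U f"
proof -
  have "C_k_on k f UNIV" for k
  proof (cases k)
    case 0
    then show ?thesis using bounded_linear.continuous_on[OF assms continuous_on_id] by auto
  next
    case (Suc k)
    have "C_k_on (Suc k') f UNIV" for k'
      by (rule C_k_on_SucI[OF open_UNIV bounded_linear_imp_has_derivative[OF assms] C_k_on_const])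
    then show ?thesis using Suc by metis
  qed
  then show ?thesis unfolding smooth_on_def using C_k_on_subset by blast
qed

lemma smooth_on_real_polynomial_function:
  "real_polynomial_function f \<Longrightarrow> open U \<Longrightarrow> smooth_on U f"
  by (induction rule: real_polynomial_function.induct)
    (auto intro: smooth_on_bounded_linear smooth_on_const smooth_on_add smooth_on_mult)

lemma smooth_on_imp_has_vector_derivative:
  assumes "smooth_on U y" "s \<in> U"
  shows "(y has_vector_derivative vector_derivative y (at s)) (at s)"
  using smooth_on_imp_differentiable[OF assms] by (simp add: vector_derivative_works)

lemma continuous_on_vector_derivative:
  assumes "smooth_on U y"
  shows "continuous_on U (\<lambda>s. vector_derivative y (at s))"
proof -
  have "frechet_derivative y (at s) 1 = vector_derivative y (at s)" if "s \<in> U" for s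
    using smooth_on_imp_has_vector_derivative[OF assms that]
    by (metis frechet_derivative_at has_vector_derivative_def scaleR_one)
  with smooth_on_imp_continuous_on[OF smooth_on_frechet_derivative[OF assms, of 1]] show ?thesis
    by (rule continuous_on_eq)
qed


section \<open>Tangent vectors and velocities\<close>

lemma smooth_fun_lincomb:
  assumes A: "smooth_atlas A" and "smooth_fun A f" "smooth_fun A g"
  shows "smooth_fun A (\<lambda>x. a * f x + b * g x)"
  unfolding smooth_fun_def
proof
  fix C assume C: "C \<in> A"
  have "open (snd C ` fst C)" using A C by (auto simp: smooth_atlas_def)
  then show "smooth_on (snd C ` fst C) ((\<lambda>x. a * f x + b * g x) \<circ> chart_inv C)"
    using assms(2,3) C
    by (auto intro!: smooth_on_add smooth_on_mult smooth_on_const simp: smooth_fun_def o_def)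
qed

lemma smooth_fun_mult:
  assumes A: "smooth_atlas A" and "smooth_fun A f" "smooth_fun A g"
  shows "smooth_fun A (\<lambda>x. f x * g x)"
  unfolding smooth_fun_def
proof
  fix C assume C: "C \<in> A"
  have "open (snd C ` fst C)" using A C by (auto simp: smooth_atlas_def)
  then show "smooth_on (snd C ` fst C) ((\<lambda>x. f x * g x) \<circ> chart_inv C)"
    using assms(2,3) C smooth_on_mult[of "snd C ` fst C" "f \<circ> chart_inv C" "g \<circ> chart_inv C"]
    by (auto simp: smooth_fun_def o_def)
qed

lemma zero_tvec_in_tangent_space: "zero_tvec \<in> tangent_space A x"
  by (simp add: tangent_space_def zero_tvec_def)

lemma tangent_space_lincomb:
  assumes "v \<in> tangent_space A x" "w \<in> tangent_space A x"
  shows "(\<lambda>f. a * v f + b * w f) \<in> tangent_space A x"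
  using assms by (auto simp: tangent_space_def algebra_simps)

lemma chart_inv_snd:
  assumes "smooth_atlas A" "C \<in> A" "x \<in> fst C"
  shows "chart_inv C (snd C x) = x"
  using assms unfolding smooth_atlas_def homeomorphism_def by blast

lemma smooth_fun_has_derivative:
  assumes "smooth_atlas A" "C \<in> A" "x \<in> fst C" "smooth_fun A f"
  shows "((f \<circ> chart_inv C) has_derivative frechet_derivative (f \<circ> chart_inv C) (at (snd C x)))
    (at (snd C x))"
proof -
  have "smooth_on (snd C ` fst C) (f \<circ> chart_inv C)" using assms(2,4) by (simp add: smooth_fun_def)
  from smooth_on_imp_differentiable[OF this, of "snd C x"] show ?thesis
    using assms(3) by (simp add: frechet_derivative_works[symmetric])
qed

lemma coord_tvec_in_tangent_space:
  assumes A: "smooth_atlas A" and C: "C \<in> A" and x: "x \<in> fst C"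
  shows "coord_tvec A C e x \<in> tangent_space A x"
proof -
  note D = smooth_fun_has_derivative[OF A C x]
  have "coord_tvec A C e x (\<lambda>y. a * f y + b * g y) = a * coord_tvec A C e x f + b * coord_tvec A C e x g"
    if f: "smooth_fun A f" and g: "smooth_fun A g" for f g a b
  proof -
    have "((\<lambda>y. a * f y + b * g y) \<circ> chart_inv C has_derivative
        (\<lambda>h. a * frechet_derivative (f \<circ> chart_inv C) (at (snd C x)) h
           + b * frechet_derivative (g \<circ> chart_inv C) (at (snd C x)) h)) (at (snd C x))"
      using has_derivative_add[OF has_derivative_mult_right[OF D[OF f], of a]
          has_derivative_mult_right[OF D[OF g], of b]] by (simp add: o_def)
    from frechet_derivative_at[OF this, symmetric] show ?thesis
      using f g by (simp add: coord_tvec_def smooth_fun_lincomb[OF A])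
  qed
  moreover have "coord_tvec A C e x (\<lambda>y. f y * g y) = f x * coord_tvec A C e x g + g x * coord_tvec A C e x f"
    if f: "smooth_fun A f" and g: "smooth_fun A g" for f g
  proof -
    have "((\<lambda>y. f y * g y) \<circ> chart_inv C has_derivative
        (\<lambda>h. f x * frechet_derivative (g \<circ> chart_inv C) (at (snd C x)) h
           + frechet_derivative (f \<circ> chart_inv C) (at (snd C x)) h * g x)) (at (snd C x))"
      using has_derivative_mult[OF D[OF f] D[OF g]]
      by (simp add: o_def chart_inv_snd[OF A C x])
    from frechet_derivative_at[OF this, symmetric] show ?thesis
      using f g by (simp add: coord_tvec_def smooth_fun_mult[OF A])
  qed
  ultimately show ?thesis by (simp add: tangent_space_def) (simp add: coord_tvec_def)
qed

text \<open>Linearity of forms is assumed for two terms; in a chart it is applied to the expansion of a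
  vector in the coordinate basis.\<close>

lemma tangent_space_linear_sum:
  assumes lin: "\<And>v w a b. v \<in> tangent_space A x \<Longrightarrow> w \<in> tangent_space A x \<Longrightarrow>
      L (\<lambda>f. a * v f + b * w f) = a * L v + b * L w"
    and "finite B" "\<And>e. e \<in> B \<Longrightarrow> u e \<in> tangent_space A x"
  shows "(\<lambda>f. \<Sum>e\<in>B. a e * u e f) \<in> tangent_space A x \<and>
    L (\<lambda>f. \<Sum>e\<in>B. a e * u e f) = (\<Sum>e\<in>B. a e * L (u e))"
  using assms(2,3)
proof (induction B rule: finite_induct)
  case empty
  show ?case
    using zero_tvec_in_tangent_space[of A x] lin[of zero_tvec zero_tvec 0 0]
    by (simp add: zero_tvec_def)
next
  case (insert e B)
  then have IH: "(\<lambda>f. \<Sum>e\<in>B. a e * u e f) \<in> tangent_space A x"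
    "L (\<lambda>f. \<Sum>e\<in>B. a e * u e f) = (\<Sum>e\<in>B. a e * L (u e))" by auto
  from insert have u: "u e \<in> tangent_space A x" by auto
  from insert show ?case
    using tangent_space_lincomb[OF u IH(1), of "a e" 1] lin[OF u IH(1), of "a e" 1] IH(2) by simp
qed

lemma open_curve_chart:
  assumes "smooth_atlas A" "smooth_curve_open A U c" "C \<in> A"
  shows "open (U \<inter> c -` fst C)"
  using assms unfolding smooth_curve_open_def smooth_atlas_def
  by (auto intro: continuous_open_preimage)

lemma smooth_fun_curve_derivative:
  assumes A: "smooth_atlas A" and c: "smooth_curve_open A U c" and C: "C \<in> A"
    and s: "s \<in> U \<inter> c -` fst C" and f: "smooth_fun A f"
  shows "((f \<circ> c) has_vector_derivative
    (\<Sum>e\<in>Basis. (vector_derivative (snd C \<circ> c) (at s) \<bullet> e) * coord_tvec A C e (c s) f)) (at s)"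
proof -
  let ?y = "snd C \<circ> c" and ?f = "f \<circ> chart_inv C"
  let ?D = "frechet_derivative ?f (at (?y s))" and ?v = "vector_derivative (snd C \<circ> c) (at s)"
  have y: "(?y has_vector_derivative ?v) (at s)"
    using c C s smooth_on_imp_has_vector_derivative unfolding smooth_curve_open_def by blast
  have D: "(?f has_derivative ?D) (at (?y s))"
    using smooth_fun_has_derivative[OF A C _ f] s by auto
  have lin: "linear ?D" using D by (rule has_derivative_linear)
  have "((?f \<circ> ?y) has_vector_derivative ?D ?v) (at s)"
    using vector_derivative_diff_chain_within[OF y, of ?f ?D] D
    by (auto intro: has_derivative_at_withinI)
  then have "((f \<circ> c) has_vector_derivative ?D ?v) (at s)"
    by (rule has_vector_derivative_transform_within_open[OF _ open_curve_chart[OF A c C] s])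
      (auto simp: chart_inv_snd[OF A C])
  moreover have "?D ?v = (\<Sum>e\<in>Basis. (?v \<bullet> e) * ?D e)"
  proof -
    have "?D ?v = ?D (\<Sum>e\<in>Basis. (?v \<bullet> e) *\<^sub>R e)" by (simp add: euclidean_representation)
    also have "\<dots> = (\<Sum>e\<in>Basis. (?v \<bullet> e) * ?D e)" by (simp only: linear_sum[OF lin] linear_scale[OF lin] real_scaleR_def)
    finally show ?thesis .
  qed
  ultimately show ?thesis using f by (simp add: coord_tvec_def)
qed

lemma velocity_in_chart:
  assumes A: "smooth_atlas A" and c: "smooth_curve_open A U c" and C: "C \<in> A"
    and s: "s \<in> U \<inter> c -` fst C"
  shows "velocity A UNIV c s =
    (\<lambda>f. \<Sum>e\<in>Basis. (vector_derivative (snd C \<circ> c) (at s) \<bullet> e) * coord_tvec A C e (c s) f)"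
proof
  fix f
  show "velocity A UNIV c s f =
    (\<Sum>e\<in>Basis. (vector_derivative (snd C \<circ> c) (at s) \<bullet> e) * coord_tvec A C e (c s) f)"
    using vector_derivative_at[OF smooth_fun_curve_derivative[OF assms, of f]]
    by (cases "smooth_fun A f") (auto simp: velocity_def coord_tvec_def)
qed

lemma smooth_fun_curve_has_velocity:
  assumes A: "smooth_atlas A" and c: "smooth_curve_open A U c" and s: "s \<in> U" and f: "smooth_fun A f"
  shows "((f \<circ> c) has_vector_derivative velocity A UNIV c s f) (at s)"
proof -
  obtain C where C: "C \<in> A" "c s \<in> fst C" using A unfolding smooth_atlas_def by blast
  then show ?thesis
    using smooth_fun_curve_derivative[OF A c C(1) _ f, of s] velocity_in_chart[OF A c C(1), of s] s by auto
qed

text \<open>The velocity within an interval only depends on the values of the curve there, so it agrees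
  with the two-sided velocity of a smooth extension.\<close>

lemma velocity_eq_of_extension:
  assumes A: "smooth_atlas A" and c: "smooth_curve_open A U c'" and "{p..q} \<subseteq> U"
    and eq: "\<forall>s\<in>{p..q}. c' s = c s" and "p < q" and s: "s \<in> {p..q}"
  shows "velocity A {p..q} c s = velocity A UNIV c' s"
proof
  fix f
  show "velocity A {p..q} c s f = velocity A UNIV c' s f"
  proof (cases "smooth_fun A f")
    case True
    have "((f \<circ> c') has_vector_derivative velocity A UNIV c' s f) (at s within {p..q})"
      using smooth_fun_curve_has_velocity[OF A c _ True, of s] s assms(3)
      by (blast intro: has_vector_derivative_at_within)
    then have "((f \<circ> c) has_vector_derivative velocity A UNIV c' s f) (at s within {p..q})"
      by (rule has_vector_derivative_transform_within[OF _ zero_less_one]) (use eq s in auto)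
    then show ?thesis
      using vector_derivative_within_closed_interval[OF \<open>p < q\<close> s] True by (simp add: velocity_def)
  qed (simp add: velocity_def)
qed

lemma velocity_interior:
  assumes "a \<le> p" "q \<le> b" "s \<in> {p<..<q}"
  shows "velocity A {a..b} c s = velocity A {p..q} c s"
  using assms by (auto simp: velocity_def at_within_Icc_at fun_eq_iff)

section \<open>The Fermat metric along a curve\<close>

lemma som_spacetimeD:
  assumes "som_spacetime A \<beta> \<omega> g0"
  shows som_smooth_atlas: "smooth_atlas A"
    and som_smooth_fun: "smooth_fun A \<beta>"
    and som_pos: "\<beta> x > 0"
    and som_one_form: "one_form A \<omega>"
    and som_sym_2_tensor: "sym_2_tensor A g0"
    and som_pos_def: "v \<in> tangent_space A x \<Longrightarrow> v \<noteq> zero_tvec \<Longrightarrow>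
      g0 x v v + (1 / \<beta> x) * (\<omega> x v)\<^sup>2 > 0"
  using assms unfolding som_spacetime_def by blast+

lemma one_form_sum:
  assumes "one_form A \<omega>" "finite B" "\<And>e. e \<in> B \<Longrightarrow> u e \<in> tangent_space A x"
  shows "\<omega> x (\<lambda>f. \<Sum>e\<in>B. a e * u e f) = (\<Sum>e\<in>B. a e * \<omega> x (u e))"
  using tangent_space_linear_sum[of A x "\<omega> x" B u a] assms by (auto simp: one_form_def)

lemma sym_2_tensor_sum:
  assumes h: "sym_2_tensor A h" and B: "finite B" and u: "\<And>e. e \<in> B \<Longrightarrow> u e \<in> tangent_space A x"
  shows "h x (\<lambda>f. \<Sum>e\<in>B. a e * u e f) (\<lambda>f. \<Sum>e\<in>B. a e * u e f)
    = (\<Sum>d\<in>B. \<Sum>e\<in>B. a d * a e * h x (u d) (u e))"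
proof -
  let ?v = "\<lambda>f. \<Sum>e\<in>B. a e * u e f"
  have lin: "?v \<in> tangent_space A x \<and> h x ?v w = (\<Sum>d\<in>B. a d * h x (u d) w)"
    if "w \<in> tangent_space A x" for w
    using tangent_space_linear_sum[of A x "\<lambda>v. h x v w" B u a] h B u that
    by (auto simp: sym_2_tensor_def)
  have v: "?v \<in> tangent_space A x" using lin[OF zero_tvec_in_tangent_space] by blast
  have sym: "h x v w = h x w v" if "v \<in> tangent_space A x" "w \<in> tangent_space A x" for v w
    using h that unfolding sym_2_tensor_def by blast
  have "h x ?v ?v = (\<Sum>d\<in>B. a d * h x (u d) ?v)" using lin v by blast
  also have "\<dots> = (\<Sum>d\<in>B. a d * (\<Sum>e\<in>B. a e * h x (u d) (u e)))"
  proof (intro sum.cong refl)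
    fix d assume d: "d \<in> B"
    have "h x (u d) ?v = (\<Sum>e\<in>B. a e * h x (u e) (u d))"
      using sym[OF u[OF d] v] lin[OF u[OF d]] by simp
    also have "\<dots> = (\<Sum>e\<in>B. a e * h x (u d) (u e))"
      by (intro sum.cong refl arg_cong2[where f = "(*)"] sym u d)
    finally show "a d * h x (u d) ?v = a d * (\<Sum>e\<in>B. a e * h x (u d) (u e))" by simp
  qed
  finally show ?thesis by (simp add: sum_distrib_left mult.assoc)
qed

lemma velocity_in_tangent_space:
  assumes A: "smooth_atlas A" and c: "smooth_curve_open A U c" and s: "s \<in> U"
  shows "velocity A UNIV c s \<in> tangent_space A (c s)"
proof -
  obtain C where C: "C \<in> A" "c s \<in> fst C" using A unfolding smooth_atlas_def by blast
  show ?thesis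
    using tangent_space_linear_sum[of A "c s" "\<lambda>_. 0" Basis "\<lambda>e. coord_tvec A C e (c s)"]
      coord_tvec_in_tangent_space[OF A C] velocity_in_chart[OF A c C(1), of s] C s by auto
qed

text \<open>In a chart the Fermat metric of the velocity is an algebraic expression in the coefficients
  of \<open>\<beta>\<close>, \<open>\<omega>\<close> and \<open>g0\<close> and in the derivatives of the coordinates of the curve. It is continuous even
  where the velocity vanishes, although it need not be differentiable there.\<close>

lemma continuous_on_fermat_velocity:
  assumes som: "som_spacetime A \<beta> \<omega> g0" and c: "smooth_curve_open A U c"
  shows "continuous_on U (\<lambda>s. fermat \<beta> \<omega> g0 (c s) (velocity A UNIV c s))"
proof -
  note A = som_smooth_atlas[OF som]
  have chart: "continuous_on (U \<inter> c -` fst C) (\<lambda>s. fermat \<beta> \<omega> g0 (c s) (velocity A UNIV c s))"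
    (is "continuous_on ?V _") if C: "C \<in> A" for C
  proof -
    let ?y = "snd C \<circ> c"
    define y' where "y' = (\<lambda>s. vector_derivative ?y (at s))"
    define W where "W = (\<lambda>e s. \<omega> (c s) (coord_tvec A C e (c s)))"
    define G where "G = (\<lambda>d e s. g0 (c s) (coord_tvec A C d (c s)) (coord_tvec A C e (c s)))"
    have y: "smooth_on ?V ?y" using c C by (auto simp: smooth_curve_open_def)
    have cont_y: "continuous_on ?V ?y" using smooth_on_imp_continuous_on[OF y] .
    have cont_y': "continuous_on ?V y'" unfolding y'_def by (rule continuous_on_vector_derivative[OF y])
    have pull: "continuous_on ?V (\<lambda>s. k (c s))"
      if "smooth_on (snd C ` fst C) (\<lambda>y. k (chart_inv C y))" for k :: "'a \<Rightarrow> real"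
    proof -
      have "continuous_on ?V (\<lambda>s. k (chart_inv C (?y s)))"
        by (rule continuous_on_compose2[OF smooth_on_imp_continuous_on[OF that] cont_y]) auto
      then show ?thesis by (rule continuous_on_eq) (simp add: chart_inv_snd[OF A C])
    qed
    have cont_\<beta>: "continuous_on ?V (\<lambda>s. \<beta> (c s))"
      using som_smooth_fun[OF som] C by (intro pull) (simp add: smooth_fun_def o_def)
    have cont_W: "continuous_on ?V (W e)" if "e \<in> Basis" for e
      using som_one_form[OF som] C that unfolding W_def
      by (intro pull[of "\<lambda>x. \<omega> x (coord_tvec A C e x)"]) (simp add: one_form_def)
    have cont_G: "continuous_on ?V (G d e)" if "d \<in> Basis" "e \<in> Basis" for d e
      using som_sym_2_tensor[OF som] C that unfolding G_def
      by (intro pull[of "\<lambda>x. g0 x (coord_tvec A C d x) (coord_tvec A C e x)"]) (simp add: sym_2_tensor_def)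
    define w where "w = (\<lambda>s. \<Sum>e\<in>Basis. (y' s \<bullet> e) * W e s)"
    define q where "q = (\<lambda>s. \<Sum>d\<in>Basis. \<Sum>e\<in>Basis. (y' s \<bullet> d) * (y' s \<bullet> e) * G d e s)"
    have "\<beta> (c s) \<noteq> 0" for s using som_pos[OF som, of "c s"] by simp
    then have "continuous_on ?V (\<lambda>s. (1 / \<beta> (c s)) * w s
        + sqrt ((1 / (\<beta> (c s))\<^sup>2) * (w s)\<^sup>2 + (1 / \<beta> (c s)) * q s))"
      unfolding w_def q_def
      by (intro continuous_intros cont_\<beta> cont_W cont_G cont_y') auto
    then show ?thesis
    proof (rule continuous_on_eq)
      fix s assume s: "s \<in> ?V"
      have T: "coord_tvec A C e (c s) \<in> tangent_space A (c s)" for e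
        using coord_tvec_in_tangent_space[OF A C] s by auto
      show "(1 / \<beta> (c s)) * w s + sqrt ((1 / (\<beta> (c s))\<^sup>2) * (w s)\<^sup>2 + (1 / \<beta> (c s)) * q s)
          = fermat \<beta> \<omega> g0 (c s) (velocity A UNIV c s)"
        using one_form_sum[OF som_one_form[OF som] finite_Basis, of "\<lambda>e. coord_tvec A C e (c s)" "c s" "\<lambda>e. y' s \<bullet> e"]
          sym_2_tensor_sum[OF som_sym_2_tensor[OF som] finite_Basis, of "\<lambda>e. coord_tvec A C e (c s)" "c s" "\<lambda>e. y' s \<bullet> e"] T
        by (simp add: velocity_in_chart[OF A c C s] fermat_def w_def q_def W_def G_def y'_def)
    qed
  qed
  have U: "U = (\<Union>C\<in>A. U \<inter> c -` fst C)" using A unfolding smooth_atlas_def by blast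
  show ?thesis
    by (subst U, rule continuous_on_open_UN) (auto intro: open_curve_chart[OF A c] chart)
qed

lemma smooth_curve_velocity:
  assumes som: "som_spacetime A \<beta> \<omega> g0" and c: "smooth_curve A {p..q} c" and "p < q"
  shows continuous_on_fermat_piece:
      "continuous_on {p..q} (\<lambda>s. fermat \<beta> \<omega> g0 (c s) (velocity A {p..q} c s))"
    and velocity_piece_in_tangent_space:
      "s \<in> {p..q} \<Longrightarrow> velocity A {p..q} c s \<in> tangent_space A (c s)"
proof -
  note A = som_smooth_atlas[OF som]
  obtain U c' where U: "{p..q} \<subseteq> U" and c': "smooth_curve_open A U c'" and eq: "\<forall>s\<in>{p..q}. c' s = c s"
    using c unfolding smooth_curve_def by blast
  note vel = velocity_eq_of_extension[OF A c' U eq \<open>p < q\<close>]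
  show "continuous_on {p..q} (\<lambda>s. fermat \<beta> \<omega> g0 (c s) (velocity A {p..q} c s))"
    using continuous_on_subset[OF continuous_on_fermat_velocity[OF som c'] U]
    by (rule continuous_on_eq) (use eq vel in auto)
  show "velocity A {p..q} c s \<in> tangent_space A (c s)" if "s \<in> {p..q}"
    using velocity_in_tangent_space[OF A c', of s] vel[OF that] eq U that by auto
qed

lemma subdivision_mono:
  assumes "subdivision a b n p" "i \<le> j" "j \<le> n"
  shows "p i \<le> p j"
  using assms(2,3)
proof (induction rule: dec_induct)
  case (step k)
  then have "p k < p (Suc k)" using assms(1) by (simp add: subdivision_def)
  then show ?case using step by simp
qed simp

lemma has_integral_subdivision:
  fixes f :: "real \<Rightarrow> real"
  assumes p: "subdivision a b n p" and f: "\<And>i. i < n \<Longrightarrow> (f has_integral I i) {p i..p (Suc i)}"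
  shows "(f has_integral (\<Sum>i<n. I i)) {a..b}"
proof -
  have "(f has_integral (\<Sum>i<k. I i)) {p 0..p k}" if "k \<le> n" for k
    using that
  proof (induction k)
    case (Suc k)
    then show ?case
      using has_integral_combine[of "p 0" "p k" "p (Suc k)" f "\<Sum>i<k. I i" "I k"] f[of k]
        subdivision_mono[OF p, of 0 k] subdivision_mono[OF p, of k "Suc k"] by simp
  qed (simp add: has_integral_refl)
  from this[of n] show ?thesis using p by (simp add: subdivision_def)
qed

lemma fermat_length_subdivision:
  assumes som: "som_spacetime A \<beta> \<omega> g0" and p: "subdivision a b n p"
    and c: "\<And>i. i < n \<Longrightarrow> smooth_curve A {p i..p (Suc i)} c"
  shows "fermat_length A \<beta> \<omega> g0 a b c = (\<Sum>i<n.
    integral {p i..p (Suc i)} (\<lambda>s. fermat \<beta> \<omega> g0 (c s) (velocity A {p i..p (Suc i)} c s)))"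
  unfolding fermat_length_def
proof (intro integral_unique has_integral_subdivision[OF p])
  fix i assume i: "i < n"
  have "p i < p (Suc i)" using p i by (simp add: subdivision_def)
  have ab: "a \<le> p i" "p (Suc i) \<le> b"
    using subdivision_mono[OF p, of 0 i] subdivision_mono[OF p, of "Suc i" n] p i
    by (auto simp: subdivision_def)
  show "((\<lambda>s. fermat \<beta> \<omega> g0 (c s) (velocity A {a..b} c s)) has_integral
      integral {p i..p (Suc i)} (\<lambda>s. fermat \<beta> \<omega> g0 (c s) (velocity A {p i..p (Suc i)} c s))) {p i..p (Suc i)}"
  proof (rule has_integral_spike_finite[where S = "{p i, p (Suc i)}"])
    show "((\<lambda>s. fermat \<beta> \<omega> g0 (c s) (velocity A {p i..p (Suc i)} c s)) has_integral
      integral {p i..p (Suc i)} (\<lambda>s. fermat \<beta> \<omega> g0 (c s) (velocity A {p i..p (Suc i)} c s))) {p i..p (Suc i)}"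
      using continuous_on_fermat_piece[OF som c[OF i] \<open>p i < p (Suc i)\<close>]
      by (intro integrable_integral integrable_continuous_real)
  qed (auto simp: velocity_interior[OF ab])
qed

lemma fermat_dist_refl:
  assumes "som_spacetime A \<beta> \<omega> g0"
  shows "fermat_dist A \<beta> \<omega> g0 x x \<le> 0"
proof -
  note A = som_smooth_atlas[OF assms]
  have "smooth_curve A {0..1} (\<lambda>_. x)"
    unfolding smooth_curve_def smooth_curve_open_def
    by (intro exI[of _ UNIV] exI[of _ "\<lambda>_. x"]) (auto simp: o_def smooth_on_const)
  then have ps: "piecewise_smooth A 0 1 (\<lambda>_. x)"
    unfolding piecewise_smooth_def subdivision_def
    by (intro exI[of _ 1] exI[of _ real]) auto
  have "vector_derivative (f \<circ> (\<lambda>_. x)) (at s within {0..1}) = 0" if "s \<in> {0..1}" for f :: "'a \<Rightarrow> real" and s :: real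
    using that by (intro vector_derivative_within_closed_interval) (auto simp: o_def)
  then have "velocity A {0..1} (\<lambda>_. x) s = zero_tvec" if "s \<in> {0..1}" for s
    using that by (auto simp: velocity_def zero_tvec_def fun_eq_iff)
  moreover have "\<omega> x zero_tvec = 0" "g0 x zero_tvec zero_tvec = 0"
    using one_form_sum[OF som_one_form[OF assms], of "{}" undefined x]
      sym_2_tensor_sum[OF som_sym_2_tensor[OF assms], of "{}" undefined x] by (auto simp: zero_tvec_def)
  ultimately have "fermat_length A \<beta> \<omega> g0 0 1 (\<lambda>_. x) = integral {0..1} (\<lambda>_::real. 0::real)"
    unfolding fermat_length_def by (intro integral_cong) (simp add: fermat_def)
  then have "fermat_length A \<beta> \<omega> g0 0 1 (\<lambda>_. x) = 0" by simp
  with ps show ?thesis unfolding fermat_dist_def zero_ereal_def by (intro Inf_lower) force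
qed


section \<open>Future-directed vectors\<close>

text \<open>The causal type of \<open>(\<tau>, v)\<close> is a question about a quadratic polynomial in \<open>\<tau>\<close>. Completing the
  square shows that its roots are symmetric about \<open>\<omega>(v)/\<beta>\<close>, that the future-directed vectors lie to the
  right of this centre, and that the larger root is the Fermat metric.\<close>

lemma som_metric_complete_square:
  assumes som: "som_spacetime A \<beta> \<omega> g0" and v: "v \<in> tangent_space A x"
  shows "som_metric \<beta> \<omega> g0 (t, x) (\<tau>, v) (\<tau>, v)
      = \<beta> x * (((1 / (\<beta> x)\<^sup>2) * (\<omega> x v)\<^sup>2 + (1 / \<beta> x) * g0 x v v) - (\<tau> - \<omega> x v / \<beta> x)\<^sup>2)"
    and "som_metric \<beta> \<omega> g0 (t, x) (\<tau>, v) (1, zero_tvec) = - \<beta> x * (\<tau> - \<omega> x v / \<beta> x)"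
proof -
  have b: "\<beta> x \<noteq> 0" using som_pos[OF som, of x] by simp
  show "som_metric \<beta> \<omega> g0 (t, x) (\<tau>, v) (\<tau>, v)
      = \<beta> x * (((1 / (\<beta> x)\<^sup>2) * (\<omega> x v)\<^sup>2 + (1 / \<beta> x) * g0 x v v) - (\<tau> - \<omega> x v / \<beta> x)\<^sup>2)"
    using b by (simp add: som_metric_def field_simps power2_eq_square)
  have Z: "zero_tvec \<in> tangent_space A x" by (rule zero_tvec_in_tangent_space)
  have "\<forall>w\<in>tangent_space A x. \<forall>w'\<in>tangent_space A x. \<forall>a b.
      \<omega> x (\<lambda>f. a * w f + b * w' f) = a * \<omega> x w + b * \<omega> x w'"
    using som_one_form[OF som] unfolding one_form_def by blast
  from this[rule_format, OF Z Z, of 0 0] have "\<omega> x zero_tvec = 0" by (simp add: zero_tvec_def)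
  moreover have "g0 x v zero_tvec = 0"
  proof -
    have "g0 x v zero_tvec = g0 x zero_tvec v"
      using som_sym_2_tensor[OF som] v Z unfolding sym_2_tensor_def by blast
    also have "\<forall>u\<in>tangent_space A x. \<forall>w\<in>tangent_space A x. \<forall>w'\<in>tangent_space A x. \<forall>a b.
        g0 x (\<lambda>f. a * w f + b * w' f) u = a * g0 x w u + b * g0 x w' u"
      using som_sym_2_tensor[OF som] unfolding sym_2_tensor_def by blast
    from this[rule_format, OF v Z Z, of 0 0] have "g0 x zero_tvec v = 0" by (simp add: zero_tvec_def)
    finally show ?thesis .
  qed
  ultimately show "som_metric \<beta> \<omega> g0 (t, x) (\<tau>, v) (1, zero_tvec) = - \<beta> x * (\<tau> - \<omega> x v / \<beta> x)"
    using b by (simp add: som_metric_def field_simps)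
qed

lemma fermat_radicand:
  assumes som: "som_spacetime A \<beta> \<omega> g0" and v: "v \<in> tangent_space A x"
  defines "R \<equiv> (1 / (\<beta> x)\<^sup>2) * (\<omega> x v)\<^sup>2 + (1 / \<beta> x) * g0 x v v"
  shows "v \<noteq> zero_tvec \<Longrightarrow> 0 < R"
    and "v = zero_tvec \<Longrightarrow> R = 0 \<and> \<omega> x v = 0"
proof -
  have b: "0 < \<beta> x" using som_pos[OF som] .
  show "0 < R" if "v \<noteq> zero_tvec"
  proof -
    have "R = (1 / \<beta> x) * (g0 x v v + (1 / \<beta> x) * (\<omega> x v)\<^sup>2)"
      using b by (simp add: R_def field_simps power2_eq_square)
    then show ?thesis using som_pos_def[OF som v that] b by simp
  qed
  show "R = 0 \<and> \<omega> x v = 0" if "v = zero_tvec"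
    using one_form_sum[OF som_one_form[OF som], of "{}" undefined x]
      sym_2_tensor_sum[OF som_sym_2_tensor[OF som], of "{}" undefined x] that
    by (auto simp: zero_tvec_def R_def)
qed

lemma future_timelike_iff:
  assumes som: "som_spacetime A \<beta> \<omega> g0" and v: "v \<in> tangent_space A x"
  shows "timelike \<beta> \<omega> g0 (t, x) (\<tau>, v) \<and> future_directed \<beta> \<omega> g0 (t, x) (\<tau>, v)
    \<longleftrightarrow> fermat \<beta> \<omega> g0 x v < \<tau>"
proof -
  define R where "R = (1 / (\<beta> x)\<^sup>2) * (\<omega> x v)\<^sup>2 + (1 / \<beta> x) * g0 x v v"
  define \<sigma> where "\<sigma> = \<tau> - \<omega> x v / \<beta> x"
  have b: "0 < \<beta> x" using som_pos[OF som] .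
  have R: "0 \<le> R" using fermat_radicand[OF som v] unfolding R_def by fastforce
  have "timelike \<beta> \<omega> g0 (t, x) (\<tau>, v) \<and> future_directed \<beta> \<omega> g0 (t, x) (\<tau>, v) \<longleftrightarrow> R < \<sigma>\<^sup>2 \<and> 0 < \<sigma>"
    using b unfolding timelike_def future_directed_def causal_def
      som_metric_complete_square[OF som v] R_def[symmetric] \<sigma>_def[symmetric]
    by (auto simp: mult_less_0_iff zero_less_mult_iff)
  also have "\<dots> \<longleftrightarrow> sqrt R < \<sigma>"
    using R by (metis abs_of_pos le_less_trans real_sqrt_abs real_sqrt_ge_zero real_sqrt_less_iff)
  also have "\<dots> \<longleftrightarrow> fermat \<beta> \<omega> g0 x v < \<tau>"
    by (auto simp: fermat_def R_def \<sigma>_def)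
  finally show ?thesis .
qed

text \<open>Positive definiteness makes the roots distinct for \<open>v \<noteq> 0\<close>, so that the larger one lies strictly to
  the right of the centre. For \<open>v = 0\<close> they both equal \<open>0\<close>, and only the zero vector, which is not
  lightlike, satisfies \<open>\<tau> = F(v)\<close>.\<close>

lemma future_lightlike_iff:
  assumes som: "som_spacetime A \<beta> \<omega> g0" and v: "v \<in> tangent_space A x"
    and nonzero: "(\<tau>, v) \<noteq> (0, zero_tvec)"
  shows "lightlike \<beta> \<omega> g0 (t, x) (\<tau>, v) \<and> future_directed \<beta> \<omega> g0 (t, x) (\<tau>, v)
    \<longleftrightarrow> \<tau> = fermat \<beta> \<omega> g0 x v"
proof -
  define R where "R = (1 / (\<beta> x)\<^sup>2) * (\<omega> x v)\<^sup>2 + (1 / \<beta> x) * g0 x v v"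
  define \<sigma> where "\<sigma> = \<tau> - \<omega> x v / \<beta> x"
  have b: "0 < \<beta> x" using som_pos[OF som] .
  have "lightlike \<beta> \<omega> g0 (t, x) (\<tau>, v) \<and> future_directed \<beta> \<omega> g0 (t, x) (\<tau>, v) \<longleftrightarrow> R = \<sigma>\<^sup>2 \<and> 0 < \<sigma>"
    using b nonzero unfolding lightlike_def timelike_def future_directed_def causal_def
      som_metric_complete_square[OF som v] R_def[symmetric] \<sigma>_def[symmetric]
    by (auto simp: mult_less_0_iff zero_less_mult_iff)
  also have "\<dots> \<longleftrightarrow> \<sigma> = sqrt R"
  proof (cases "v = zero_tvec")
    case True
    then have "R = 0" "\<sigma> \<noteq> 0"
      using fermat_radicand(2)[OF som v] nonzero by (auto simp: R_def \<sigma>_def)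
    then show ?thesis by auto
  next
    case False
    then have "0 < R" using fermat_radicand(1)[OF som v] by (simp add: R_def)
    then show ?thesis by auto
  qed
  also have "\<dots> \<longleftrightarrow> \<tau> = fermat \<beta> \<omega> g0 x v"
    by (auto simp: fermat_def R_def \<sigma>_def)
  finally show ?thesis .
qed

lemma future_causal_imp:
  assumes som: "som_spacetime A \<beta> \<omega> g0" and v: "v \<in> tangent_space A x"
    and "causal \<beta> \<omega> g0 (t, x) (\<tau>, v)" "future_directed \<beta> \<omega> g0 (t, x) (\<tau>, v)"
  shows "fermat \<beta> \<omega> g0 x v \<le> \<tau>"
  using future_timelike_iff[OF som v, of t \<tau>] future_lightlike_iff[OF som v, of \<tau> t] assms(3,4)
  by (auto simp: causal_def lightlike_def)


section \<open>Curves in the spacetime\<close>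

lemma smooth_curve_open_product_iff:
  fixes \<gamma> :: "real \<Rightarrow> real \<times> 'a::{t2_space,second_countable_topology}"
    and A :: "('a, 'b::euclidean_space) chart set"
  assumes A: "smooth_atlas A"
  shows "smooth_curve_open (product_atlas A) U \<gamma> \<longleftrightarrow>
    smooth_on U (\<lambda>s. fst (\<gamma> s)) \<and> smooth_curve_open A U (\<lambda>s. snd (\<gamma> s))" (is "?L \<longleftrightarrow> ?R")
proof -
  let ?V = "\<lambda>C. U \<inter> (\<lambda>s. snd (\<gamma> s)) -` fst C"
  have L: "?L \<longleftrightarrow> open U \<and> continuous_on U \<gamma> \<and>
      (\<forall>C\<in>A. smooth_on (?V C) (\<lambda>s. (fst (\<gamma> s), snd C (snd (\<gamma> s)))))"
  proof -
    have "U \<inter> \<gamma> -` (UNIV \<times> fst C) = ?V C"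
      and "map_prod id (snd C) \<circ> \<gamma> = (\<lambda>s. (fst (\<gamma> s), snd C (snd (\<gamma> s))))" for C :: "('a, 'b) chart"
      by (auto simp: vimage_def mem_Times_iff fun_eq_iff map_prod_def split_beta)
    then show ?thesis by (simp add: smooth_curve_open_def product_atlas_def)
  qed
  show ?thesis
  proof
    assume ?L
    then have U: "open U" and cont: "continuous_on U \<gamma>"
      and sm: "\<And>C. C \<in> A \<Longrightarrow> smooth_on (?V C) (\<lambda>s. (fst (\<gamma> s), snd C (snd (\<gamma> s))))"
      using L by auto
    have cont': "continuous_on U (\<lambda>s. snd (\<gamma> s))" using cont by (intro continuous_on_snd)
    have op: "open (?V C)" if "C \<in> A" for C
      using A that by (intro continuous_open_preimage cont' U) (auto simp: smooth_atlas_def)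
    have "smooth_on (?V C) (\<lambda>s. fst (\<gamma> s))" "smooth_on (?V C) (\<lambda>s. snd C (snd (\<gamma> s)))" if "C \<in> A" for C
      using smooth_on_linear[OF op[OF that] bounded_linear_fst sm[OF that]]
        smooth_on_linear[OF op[OF that] bounded_linear_snd sm[OF that]] by simp_all
    moreover have "U = (\<Union>C\<in>A. ?V C)" using A unfolding smooth_atlas_def by blast
    ultimately show ?R
      using U cont' C_k_on_open_UN[of A ?V, OF op] unfolding smooth_on_def smooth_curve_open_def o_def by metis
  next
    assume R: ?R
    then have U: "open U" and t: "smooth_on U (\<lambda>s. fst (\<gamma> s))"
      and c: "smooth_curve_open A U (\<lambda>s. snd (\<gamma> s))" by (auto simp: smooth_curve_open_def)
    have "continuous_on U (\<lambda>s. (fst (\<gamma> s), snd (\<gamma> s)))"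
      using smooth_on_imp_continuous_on[OF t] c by (intro continuous_on_Pair) (auto simp: smooth_curve_open_def)
    moreover have "smooth_on (?V C) (\<lambda>s. (fst (\<gamma> s), snd C (snd (\<gamma> s))))" if "C \<in> A" for C
      using c that
      by (intro smooth_on_Pair open_curve_chart[OF A c that] smooth_on_subset[OF t])
        (auto simp: smooth_curve_open_def o_def)
    ultimately show ?L using U L by simp
  qed
qed

lemma smooth_curve_product:
  assumes A: "smooth_atlas A" and \<gamma>: "smooth_curve (product_atlas A) {p..q} \<gamma>" and "p < q"
  defines "\<tau> \<equiv> \<lambda>s. fst (velocity_M A {p..q} \<gamma> s)"
  shows smooth_curve_product_snd: "smooth_curve A {p..q} (\<lambda>s. snd (\<gamma> s))"
    and continuous_on_product_time: "continuous_on {p..q} \<tau>"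
    and has_integral_product_time: "(\<tau> has_integral fst (\<gamma> q) - fst (\<gamma> p)) {p..q}"
proof -
  obtain U \<gamma>' where U: "{p..q} \<subseteq> U" and \<gamma>': "smooth_curve_open (product_atlas A) U \<gamma>'"
    and eq: "\<forall>s\<in>{p..q}. \<gamma>' s = \<gamma> s"
    using \<gamma> unfolding smooth_curve_def by blast
  then have t: "smooth_on U (\<lambda>s. fst (\<gamma>' s))" and c: "smooth_curve_open A U (\<lambda>s. snd (\<gamma>' s))"
    using smooth_curve_open_product_iff[OF A] by blast+
  show "smooth_curve A {p..q} (\<lambda>s. snd (\<gamma> s))"
    unfolding smooth_curve_def using U c eq by (intro exI[of _ U] exI[of _ "\<lambda>s. snd (\<gamma>' s)"]) auto
  let ?D = "\<lambda>s. vector_derivative (\<lambda>s. fst (\<gamma>' s)) (at s)"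
  have D: "((\<lambda>s. fst (\<gamma> s)) has_vector_derivative ?D s) (at s within {p..q})" if s: "s \<in> {p..q}" for s
  proof -
    have "((\<lambda>s. fst (\<gamma>' s)) has_vector_derivative ?D s) (at s within {p..q})"
      using smooth_on_imp_has_vector_derivative[OF t] U s by (blast intro: has_vector_derivative_at_within)
    then show ?thesis
      by (rule has_vector_derivative_transform_within[OF _ zero_less_one s]) (use eq in auto)
  qed
  have \<tau>: "?D s = \<tau> s" if "s \<in> {p..q}" for s
    using vector_derivative_within_closed_interval[OF \<open>p < q\<close> that D[OF that]]
    by (simp add: \<tau>_def velocity_M_def o_def)
  show "continuous_on {p..q} \<tau>"
    using continuous_on_subset[OF continuous_on_vector_derivative[OF t] U] \<tau> by (rule continuous_on_eq)
  show "(\<tau> has_integral fst (\<gamma> q) - fst (\<gamma> p)) {p..q}"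
  proof (rule fundamental_theorem_of_calculus)
    show "((\<lambda>s. fst (\<gamma> s)) has_vector_derivative \<tau> s) (at s within {p..q})" if "s \<in> {p..q}" for s
      using D[OF that] \<tau>[OF that] by simp
  qed (use \<open>p < q\<close> in simp)
qed

text \<open>Shared by timelike and causal curves: with \<open>R\<close> one of the two relations \<open><\<close> and \<open>\<le>\<close>, a pointwise
  comparison of the Fermat metric with the time component integrates to the same comparison between
  the Fermat length and the elapsed time.\<close>

lemma fermat_length_compare:
  assumes som: "som_spacetime A \<beta> \<omega> g0" and sub: "subdivision a b n p"
    and \<gamma>: "\<And>i. i < n \<Longrightarrow> smooth_curve (product_atlas A) {p i..p (Suc i)} \<gamma>"
    and R: "\<And>i s. i < n \<Longrightarrow> s \<in> {p i..p (Suc i)} \<Longrightarrow>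
      R (fermat \<beta> \<omega> g0 (snd (\<gamma> s)) (velocity A {p i..p (Suc i)} (\<lambda>s. snd (\<gamma> s)) s))
        (fst (velocity_M A {p i..p (Suc i)} \<gamma> s))"
    and "R = (<) \<or> R = (\<le>)"
  shows "piecewise_smooth A a b (\<lambda>s. snd (\<gamma> s)) \<and>
    R (fermat_length A \<beta> \<omega> g0 a b (\<lambda>s. snd (\<gamma> s))) (fst (\<gamma> b) - fst (\<gamma> a))"
proof -
  note A = som_smooth_atlas[OF som]
  let ?c = "\<lambda>s. snd (\<gamma> s)"
  let ?F = "\<lambda>i. integral {p i..p (Suc i)} (\<lambda>s. fermat \<beta> \<omega> g0 (?c s) (velocity A {p i..p (Suc i)} ?c s))"
  have p: "p i < p (Suc i)" if "i < n" for i using sub that by (simp add: subdivision_def)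
  have c: "smooth_curve A {p i..p (Suc i)} ?c" if "i < n" for i
    using smooth_curve_product_snd[OF A \<gamma> p] that by blast
  have piece: "R (?F i) (fst (\<gamma> (p (Suc i))) - fst (\<gamma> (p i)))" if i: "i < n" for i
  proof -
    note contF = continuous_on_fermat_piece[OF som c[OF i] p[OF i]]
    note contT = continuous_on_product_time[OF A \<gamma>[OF i] p[OF i]]
    have "integral {p i..p (Suc i)} (\<lambda>s. fst (velocity_M A {p i..p (Suc i)} \<gamma> s))
        = fst (\<gamma> (p (Suc i))) - fst (\<gamma> (p i))"
      using has_integral_product_time[OF A \<gamma>[OF i] p[OF i]] by (rule integral_unique)
    moreover from assms(5) have "R (?F i) (integral {p i..p (Suc i)} (\<lambda>s. fst (velocity_M A {p i..p (Suc i)} \<gamma> s)))"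
    proof
      assume "R = (<)"
      then show ?thesis using integral_less_real[OF contF contT] R[OF i] p[OF i] by simp
    next
      assume "R = (\<le>)"
      then show ?thesis
        using integral_le[OF integrable_continuous_real[OF contF] integrable_continuous_real[OF contT]] R[OF i]
        by blast
    qed
    ultimately show ?thesis by simp
  qed
  have "(\<Sum>i<n. fst (\<gamma> (p (Suc i))) - fst (\<gamma> (p i))) = fst (\<gamma> b) - fst (\<gamma> a)"
    using sub sum_lessThan_telescope[of "\<lambda>i. fst (\<gamma> (p i))" n] by (simp add: subdivision_def)
  moreover have "R (\<Sum>i<n. ?F i) (\<Sum>i<n. fst (\<gamma> (p (Suc i))) - fst (\<gamma> (p i)))"
    using assms(5)
  proof
    assume "R = (<)"
    moreover have "{..<n} \<noteq> {}" using sub by (auto simp: subdivision_def)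
    ultimately show ?thesis using piece by (auto intro!: sum_strict_mono)
  next
    assume "R = (\<le>)"
    then show ?thesis using piece by (auto intro!: sum_mono)
  qed
  ultimately show ?thesis
    using fermat_length_subdivision[OF som sub c] sub c unfolding piecewise_smooth_def by auto
qed

lemma fermat_dist_le_length:
  assumes "piecewise_smooth A a b c"
  shows "fermat_dist A \<beta> \<omega> g0 (c a) (c b) \<le> ereal (fermat_length A \<beta> \<omega> g0 a b c)"
  unfolding fermat_dist_def using assms by (intro Inf_lower) blast

lemma chron_le_imp_fermat_dist:
  assumes som: "som_spacetime A \<beta> \<omega> g0" and "chron_le A \<beta> \<omega> g0 (t0, x0) (t1, x1)"
  shows "fermat_dist A \<beta> \<omega> g0 x0 x1 < ereal (t1 - t0)"
proof -
  obtain a b \<gamma> n p where \<gamma>: "\<gamma> a = (t0, x0)" "\<gamma> b = (t1, x1)" and sub: "subdivision a b n p"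
    and piece: "\<And>i. i < n \<Longrightarrow> smooth_curve (product_atlas A) {p i..p (Suc i)} \<gamma>"
    and tl: "\<And>i s. i < n \<Longrightarrow> s \<in> {p i..p (Suc i)} \<Longrightarrow>
      timelike \<beta> \<omega> g0 (\<gamma> s) (velocity_M A {p i..p (Suc i)} \<gamma> s) \<and>
      future_directed \<beta> \<omega> g0 (\<gamma> s) (velocity_M A {p i..p (Suc i)} \<gamma> s)"
    using assms(2) unfolding chron_le_def fd_timelike_curve_def Let_def by blast
  let ?c = "\<lambda>s. snd (\<gamma> s)"
  have "fermat \<beta> \<omega> g0 (?c s) (velocity A {p i..p (Suc i)} ?c s) < fst (velocity_M A {p i..p (Suc i)} \<gamma> s)"
    if i: "i < n" and s: "s \<in> {p i..p (Suc i)}" for i s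
  proof -
    have p: "p i < p (Suc i)" using sub i by (simp add: subdivision_def)
    have v: "velocity A {p i..p (Suc i)} ?c s \<in> tangent_space A (?c s)"
      using velocity_piece_in_tangent_space[OF som smooth_curve_product_snd[OF som_smooth_atlas[OF som] piece[OF i] p] p s] .
    show ?thesis
      using future_timelike_iff[OF som v, of "fst (\<gamma> s)" "fst (velocity_M A {p i..p (Suc i)} \<gamma> s)"] tl[OF i s]
      by (simp add: velocity_M_def o_def)
  qed
  then have "piecewise_smooth A a b ?c \<and> fermat_length A \<beta> \<omega> g0 a b ?c < fst (\<gamma> b) - fst (\<gamma> a)"
    by (intro fermat_length_compare[OF som sub piece]) auto
  then show ?thesis using fermat_dist_le_length[of A a b ?c \<beta> \<omega> g0] \<gamma> by (auto intro: le_less_trans)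
qed

lemma causal_le_imp_fermat_dist:
  assumes som: "som_spacetime A \<beta> \<omega> g0" and "causal_le A \<beta> \<omega> g0 (t0, x0) (t1, x1)"
  shows "fermat_dist A \<beta> \<omega> g0 x0 x1 \<le> ereal (t1 - t0)"
proof (cases "(t0, x0) = (t1, x1)")
  case True
  then show ?thesis using fermat_dist_refl[OF som, of x0] by (simp add: zero_ereal_def)
next
  case False
  then obtain a b \<gamma> n p where \<gamma>: "\<gamma> a = (t0, x0)" "\<gamma> b = (t1, x1)" and sub: "subdivision a b n p"
    and piece: "\<And>i. i < n \<Longrightarrow> smooth_curve (product_atlas A) {p i..p (Suc i)} \<gamma>"
    and cs: "\<And>i s. i < n \<Longrightarrow> s \<in> {p i..p (Suc i)} \<Longrightarrow>
      causal \<beta> \<omega> g0 (\<gamma> s) (velocity_M A {p i..p (Suc i)} \<gamma> s) \<and>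
      future_directed \<beta> \<omega> g0 (\<gamma> s) (velocity_M A {p i..p (Suc i)} \<gamma> s)"
    using assms(2) unfolding causal_le_def fd_causal_curve_def Let_def by blast
  let ?c = "\<lambda>s. snd (\<gamma> s)"
  have "fermat \<beta> \<omega> g0 (?c s) (velocity A {p i..p (Suc i)} ?c s) \<le> fst (velocity_M A {p i..p (Suc i)} \<gamma> s)"
    if i: "i < n" and s: "s \<in> {p i..p (Suc i)}" for i s
  proof -
    have p: "p i < p (Suc i)" using sub i by (simp add: subdivision_def)
    have v: "velocity A {p i..p (Suc i)} ?c s \<in> tangent_space A (?c s)"
      using velocity_piece_in_tangent_space[OF som smooth_curve_product_snd[OF som_smooth_atlas[OF som] piece[OF i] p] p s] .
    show ?thesis
      using future_causal_imp[OF som v, of "fst (\<gamma> s)" "fst (velocity_M A {p i..p (Suc i)} \<gamma> s)"] cs[OF i s]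
      by (simp add: velocity_M_def o_def)
  qed
  then have "piecewise_smooth A a b ?c \<and> fermat_length A \<beta> \<omega> g0 a b ?c \<le> fst (\<gamma> b) - fst (\<gamma> a)"
    by (intro fermat_length_compare[OF som sub piece]) auto
  then show ?thesis using fermat_dist_le_length[of A a b ?c \<beta> \<omega> g0] \<gamma> by (auto intro: order_trans)
qed


section \<open>Timelike curves over a given curve\<close>

lemma real_polynomial_antiderivative:
  fixes g :: "real \<Rightarrow> real"
  assumes "real_polynomial_function g"
  obtains G where "real_polynomial_function G" "\<And>s. (G has_vector_derivative g s) (at s)"
proof -
  obtain a n where g: "g = (\<lambda>x. \<Sum>i\<le>n. a i * x ^ i)"
    using assms by (auto simp: real_polynomial_function_iff_sum)
  let ?G = "\<lambda>x. \<Sum>i\<le>n. (a i / Suc i) * x ^ Suc i"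
  have x: "real_polynomial_function (\<lambda>x::real. x)"
    by (rule real_polynomial_function.intros(1)) (rule bounded_linear_ident)
  have "real_polynomial_function ?G"
    by (intro real_polynomial_function_sum real_polynomial_function.intros(4)
        real_polynomial_function.intros(2) real_polynomial_function_power x) simp
  moreover have "(?G has_vector_derivative g s) (at s)" for s
    unfolding g has_real_derivative_iff_has_vector_derivative[symmetric]
    by (rule DERIV_sum) (auto intro!: derivative_eq_intros simp del: of_nat_Suc power_Suc)
  ultimately show ?thesis using that by blast
qed

text \<open>In the application \<open>F\<close> is the Fermat metric of the velocity of a curve, which is in general only
  continuous and then not the derivative of a smooth time function. The slack \<open>D - \<integral>F\<close> pays for replacing it by a slightly larger
  polynomial, which the Weierstrass approximation theorem supplies.\<close>

lemma smooth_primitive_above: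
  fixes F :: "real \<Rightarrow> real"
  assumes "p < q" and F: "continuous_on {p..q} F" and D: "integral {p..q} F < D"
  obtains H h where "smooth_on UNIV H" "H q - H p = D"
    "\<And>s. (H has_vector_derivative h s) (at s)" "\<And>s. s \<in> {p..q} \<Longrightarrow> F s < h s"
proof -
  define \<eta> where "\<eta> = (D - integral {p..q} F) / (q - p)"
  have \<eta>: "0 < \<eta>" using D \<open>p < q\<close> by (simp add: \<eta>_def)
  then obtain g where g: "real_polynomial_function g" "\<And>s. s \<in> {p..q} \<Longrightarrow> \<bar>F s - g s\<bar> < \<eta> / 2"
    using Stone_Weierstrass_real_polynomial_function[of "{p..q}" F "\<eta> / 2"] F by auto
  obtain G where G: "real_polynomial_function G" "\<And>s. (G has_vector_derivative g s) (at s)"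
    using real_polynomial_antiderivative[OF g(1)] by blast
  \<comment> \<open>The error of \<open>g\<close> costs at most half of the slack, hence adding the constant \<open>\<kappa>\<close> that adjusts the
    integral to \<open>D\<close> lifts \<open>g\<close> above \<open>F\<close>.\<close>
  define \<kappa> where "\<kappa> = (D - (G q - G p)) / (q - p)"
  have "(g has_integral (G q - G p)) {p..q}"
    using \<open>p < q\<close> G(2) by (intro fundamental_theorem_of_calculus) (auto intro: has_vector_derivative_at_within)
  moreover have "((\<lambda>s. F s + \<eta> / 2) has_integral (integral {p..q} F + (q - p) * (\<eta> / 2))) {p..q}"
    using has_integral_const_real[of "\<eta> / 2" p q] \<open>p < q\<close>
    by (intro has_integral_add integrable_integral integrable_continuous_real F) simp
  ultimately have "G q - G p \<le> integral {p..q} F + (q - p) * (\<eta> / 2)"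
  proof (rule has_integral_le)
    show "g s \<le> F s + \<eta> / 2" if "s \<in> {p..q}" for s using g(2)[OF that] by linarith
  qed
  moreover have "D - integral {p..q} F = (q - p) * \<eta>" using \<open>p < q\<close> by (simp add: \<eta>_def)
  ultimately have "(q - p) * (\<eta> / 2) \<le> D - (G q - G p)" by (simp add: field_simps)
  then have \<kappa>: "\<eta> / 2 \<le> \<kappa>" using \<open>p < q\<close> by (simp add: \<kappa>_def field_simps)
  show ?thesis
  proof
    have "real_polynomial_function (\<lambda>s. G s + \<kappa> * s)"
      by (intro real_polynomial_function.intros(3) real_polynomial_function.intros(1)[OF bounded_linear_mult_right] G(1))
    then show "smooth_on UNIV (\<lambda>s. G s + \<kappa> * s)" by (rule smooth_on_real_polynomial_function) simp
    have "\<kappa> * (q - p) = D - (G q - G p)" using \<open>p < q\<close> by (simp add: \<kappa>_def)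
    then show "(G q + \<kappa> * q) - (G p + \<kappa> * p) = D" by (simp add: algebra_simps)
    show "((\<lambda>s. G s + \<kappa> * s) has_vector_derivative g s + \<kappa>) (at s)" for s
      using G(2)[of s] unfolding has_real_derivative_iff_has_vector_derivative[symmetric]
      by (auto intro!: derivative_eq_intros)
    show "F s < g s + \<kappa>" if "s \<in> {p..q}" for s using g(2)[OF that] \<kappa> by linarith
  qed
qed

text \<open>Clamping the parameter to each subinterval glues increments over the pieces into one function.\<close>

lemma sum_clamped_increments:
  fixes p :: "nat \<Rightarrow> real" and H :: "nat \<Rightarrow> real \<Rightarrow> real"
  assumes sub: "subdivision a b n p" and k: "k < n" and s: "s \<in> {p k..p (Suc k)}"
  shows "(\<Sum>i<n. H i (max (p i) (min (p (Suc i)) s)) - H i (p i))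
    = (\<Sum>i<k. H i (p (Suc i)) - H i (p i)) + (H k s - H k (p k))"
proof -
  let ?T = "\<lambda>i. H i (max (p i) (min (p (Suc i)) s)) - H i (p i)"
  have "?T i = H i (p (Suc i)) - H i (p i)" if "i < k" for i
    using subdivision_mono[OF sub, of "Suc i" k] subdivision_mono[OF sub, of i "Suc i"] that k s
    by (simp add: min_absorb1)
  moreover have "?T i = 0" if "k < i" "i < n" for i
    using subdivision_mono[OF sub, of "Suc k" i] that s by (simp add: max_absorb1 min.coboundedI2)
  moreover have "?T k = H k s - H k (p k)" using s by simp
  moreover have "(\<Sum>i<n. ?T i) = (\<Sum>i<k. ?T i) + (\<Sum>i\<in>{k..<n}. ?T i)"
    using k by (simp add: lessThan_atLeast0 sum.atLeastLessThan_concat)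
  moreover have "(\<Sum>i\<in>{k..<n}. ?T i) = ?T k + (\<Sum>i\<in>{Suc k..<n}. ?T i)"
    using k by (simp add: sum.atLeast_Suc_lessThan)
  ultimately show ?thesis by simp
qed

lemma timelike_curve_over:
  assumes som: "som_spacetime A \<beta> \<omega> g0" and c: "piecewise_smooth A a b c"
    and D: "fermat_length A \<beta> \<omega> g0 a b c < t1 - t0"
  shows "chron_le A \<beta> \<omega> g0 (t0, c a) (t1, c b)"
proof -
  note A = som_smooth_atlas[OF som]
  obtain n p where sub: "subdivision a b n p"
    and c: "\<And>i. i < n \<Longrightarrow> smooth_curve A {p i..p (Suc i)} c"
    using c unfolding piecewise_smooth_def by blast
  have n: "0 < n" and p: "\<And>i. i < n \<Longrightarrow> p i < p (Suc i)" and ab: "p 0 = a" "p n = b"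
    using sub by (auto simp: subdivision_def)
  let ?F = "\<lambda>i s. fermat \<beta> \<omega> g0 (c s) (velocity A {p i..p (Suc i)} c s)"
  \<comment> \<open>The slack is distributed evenly over the \<open>n\<close> pieces.\<close>
  define \<delta> where "\<delta> = (t1 - t0 - fermat_length A \<beta> \<omega> g0 a b c) / n"
  have \<delta>: "0 < \<delta>" using D n by (simp add: \<delta>_def)
  define T where "T i = integral {p i..p (Suc i)} (?F i) + \<delta>" for i
  have T: "(\<Sum>i<n. T i) = t1 - t0"
    using n by (simp add: T_def sum.distrib fermat_length_subdivision[OF som sub c, symmetric] \<delta>_def)
  have ex: "\<exists>H h. smooth_on UNIV H \<and> H (p (Suc i)) - H (p i) = T i \<and>
      (\<forall>s. (H has_vector_derivative h s) (at s)) \<and> (\<forall>s\<in>{p i..p (Suc i)}. ?F i s < h s)" if i: "i < n" for i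
  proof -
    have "integral {p i..p (Suc i)} (?F i) < T i" using \<delta> by (simp add: T_def)
    then show ?thesis
      by (rule smooth_primitive_above[OF p[OF i] continuous_on_fermat_piece[OF som c[OF i] p[OF i]]]) blast
  qed
  obtain H h where H: "\<And>i. i < n \<Longrightarrow> smooth_on UNIV (H i)"
    and HT: "\<And>i. i < n \<Longrightarrow> H i (p (Suc i)) - H i (p i) = T i"
    and Hh: "\<And>i s. i < n \<Longrightarrow> (H i has_vector_derivative h i s) (at s)"
    and hF: "\<And>i s. i < n \<Longrightarrow> s \<in> {p i..p (Suc i)} \<Longrightarrow> ?F i s < h i s"
    using ex by metis
  define t where "t s = t0 + (\<Sum>i<n. H i (max (p i) (min (p (Suc i)) s)) - H i (p i))" for s
  define K where "K k = t0 + (\<Sum>i<k. H i (p (Suc i)) - H i (p i)) - H k (p k)" for k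
  have t: "t s = K k + H k s" if "k < n" "s \<in> {p k..p (Suc k)}" for k s
    using sum_clamped_increments[OF sub that, of H] by (simp add: t_def K_def)
  have "t a = t0" using t[OF n, of a] p[OF n] ab by (simp add: K_def)
  moreover have "t b = t1"
  proof -
    obtain m where m: "n = Suc m" using n by (cases n) auto
    have "t b = t0 + (\<Sum>i<n. H i (p (Suc i)) - H i (p i))"
      using t[of m b] p[of m] m ab by (simp add: K_def)
    also have "(\<Sum>i<n. H i (p (Suc i)) - H i (p i)) = (\<Sum>i<n. T i)" using HT by (intro sum.cong) auto
    finally show ?thesis using T by simp
  qed
  moreover have "fd_timelike_curve A \<beta> \<omega> g0 a b (\<lambda>s. (t s, c s))"
    unfolding fd_timelike_curve_def Let_def
  proof (intro exI conjI allI impI ballI)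
    show "subdivision a b n p" by fact
    fix k assume k: "k < n"
    let ?I = "{p k..p (Suc k)}"
    show "smooth_curve (product_atlas A) ?I (\<lambda>s. (t s, c s))"
    proof -
      obtain U c' where U: "?I \<subseteq> U" and c': "smooth_curve_open A U c'" and eq: "\<forall>s\<in>?I. c' s = c s"
        using c[OF k] unfolding smooth_curve_def by blast
      have "open U" using c' by (simp add: smooth_curve_open_def)
      then have "smooth_on U (\<lambda>s. K k + H k s)"
        by (intro smooth_on_add smooth_on_const smooth_on_subset[OF H[OF k]]) auto
      then have "smooth_curve_open (product_atlas A) U (\<lambda>s. (K k + H k s, c' s))"
        using c' smooth_curve_open_product_iff[OF A, of U "\<lambda>s. (K k + H k s, c' s)"] by simp
      then show ?thesis
        unfolding smooth_curve_def using U eq t[OF k]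
        by (intro exI[of _ U] exI[of _ "\<lambda>s. (K k + H k s, c' s)"]) auto
    qed
    fix s assume s: "s \<in> ?I"
    have "((\<lambda>s. K k + H k s) has_vector_derivative h k s) (at s within ?I)"
      using has_vector_derivative_add[OF has_vector_derivative_const
          has_vector_derivative_at_within[OF Hh[OF k]]] by simp
    then have "(t has_vector_derivative h k s) (at s within ?I)"
      by (rule has_vector_derivative_transform_within[OF _ zero_less_one s]) (use t[OF k] in auto)
    then have "vector_derivative t (at s within ?I) = h k s"
      by (rule vector_derivative_within_closed_interval[OF p[OF k] s])
    then have vel: "velocity_M A ?I (\<lambda>s. (t s, c s)) s = (h k s, velocity A ?I c s)"
      by (simp add: velocity_M_def o_def)
    note tl = future_timelike_iff[OF som velocity_piece_in_tangent_space[OF som c[OF k] p[OF k] s],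
        of "t s" "h k s"]
    show "timelike \<beta> \<omega> g0 (t s, c s) (velocity_M A ?I (\<lambda>s. (t s, c s)) s)"
      and "future_directed \<beta> \<omega> g0 (t s, c s) (velocity_M A ?I (\<lambda>s. (t s, c s)) s)"
      unfolding vel using tl hF[OF k s] by blast+
  qed
  ultimately show ?thesis unfolding chron_le_def by blast
qed

lemma chron_le_iff_fermat_dist:
  assumes som: "som_spacetime A \<beta> \<omega> g0"
  shows "chron_le A \<beta> \<omega> g0 (t0, x0) (t1, x1) \<longleftrightarrow> fermat_dist A \<beta> \<omega> g0 x0 x1 < ereal (t1 - t0)"
proof
  assume "fermat_dist A \<beta> \<omega> g0 x0 x1 < ereal (t1 - t0)"
  then obtain a b c where "piecewise_smooth A a b c" "c a = x0" "c b = x1"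
    "fermat_length A \<beta> \<omega> g0 a b c < t1 - t0"
    unfolding fermat_dist_def Inf_less_iff by auto
  then show "chron_le A \<beta> \<omega> g0 (t0, x0) (t1, x1)" using timelike_curve_over[OF som] by blast
qed (rule chron_le_imp_fermat_dist[OF som])

theorem proposition3p4:
  fixes A :: "('a::{t2_space,second_countable_topology}, 'b::euclidean_space) chart set"
    and \<beta> :: "'a \<Rightarrow> real"
    and \<omega> :: "'a \<Rightarrow> 'a tvec \<Rightarrow> real"
    and g0 :: "'a \<Rightarrow> 'a tvec \<Rightarrow> 'a tvec \<Rightarrow> real"
  assumes "som_spacetime A \<beta> \<omega> g0"
  shows
    "(\<forall>t x. \<forall>\<tau>. \<forall>v\<in>tangent_space A x. (\<tau>, v) \<noteq> (0, zero_tvec) \<longrightarrow>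
        (lightlike \<beta> \<omega> g0 (t, x) (\<tau>, v) \<and> future_directed \<beta> \<omega> g0 (t, x) (\<tau>, v)
          \<longleftrightarrow> \<tau> = fermat \<beta> \<omega> g0 x v)) \<and>
     (\<forall>t x. \<forall>\<tau>. \<forall>v\<in>tangent_space A x.
        (timelike \<beta> \<omega> g0 (t, x) (\<tau>, v) \<and> future_directed \<beta> \<omega> g0 (t, x) (\<tau>, v)
          \<longleftrightarrow> \<tau> > fermat \<beta> \<omega> g0 x v)) \<and>
     (\<forall>t0 x0 t1 x1.
        (chron_le A \<beta> \<omega> g0 (t0, x0) (t1, x1)
          \<longleftrightarrow> fermat_dist A \<beta> \<omega> g0 x0 x1 < ereal (t1 - t0)) \<and>
        (causal_le A \<beta> \<omega> g0 (t0, x0) (t1, x1)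
          \<longrightarrow> fermat_dist A \<beta> \<omega> g0 x0 x1 \<le> ereal (t1 - t0)) \<and>
        chron_future A \<beta> \<omega> g0 (t0, x0)
          = (\<Union>s\<in>(UNIV :: real set). {t0 + s} \<times> ball_fwd A \<beta> \<omega> g0 x0 s) \<and>
        chron_past A \<beta> \<omega> g0 (t0, x0)
          = (\<Union>s\<in>(UNIV :: real set). {t0 - s} \<times> ball_bwd A \<beta> \<omega> g0 x0 s))"
proof (intro conjI allI impI ballI)
  fix t \<tau> t0 t1 :: real and x x0 x1 :: 'a
  note som = assms
  show "(lightlike \<beta> \<omega> g0 (t, x) (\<tau>, v) \<and> future_directed \<beta> \<omega> g0 (t, x) (\<tau>, v))
      = (\<tau> = fermat \<beta> \<omega> g0 x v)" if "v \<in> tangent_space A x" "(\<tau>, v) \<noteq> (0, zero_tvec)" for v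
    using future_lightlike_iff[OF som that] .
  show "(timelike \<beta> \<omega> g0 (t, x) (\<tau>, v) \<and> future_directed \<beta> \<omega> g0 (t, x) (\<tau>, v))
      = (fermat \<beta> \<omega> g0 x v < \<tau>)" if "v \<in> tangent_space A x" for v
    using future_timelike_iff[OF som that] .
  show "chron_le A \<beta> \<omega> g0 (t0, x0) (t1, x1) = (fermat_dist A \<beta> \<omega> g0 x0 x1 < ereal (t1 - t0))"
    by (rule chron_le_iff_fermat_dist[OF som])
  show "fermat_dist A \<beta> \<omega> g0 x0 x1 \<le> ereal (t1 - t0)" if "causal_le A \<beta> \<omega> g0 (t0, x0) (t1, x1)"
    by (rule causal_le_imp_fermat_dist[OF som that])
  show "chron_future A \<beta> \<omega> g0 (t0, x0) = (\<Union>s. {t0 + s} \<times> ball_fwd A \<beta> \<omega> g0 x0 s)"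
  proof (intro set_eqI)
    fix q :: "real \<times> 'a"
    have "(\<exists>s. fst q = t0 + s \<and> P s) \<longleftrightarrow> P (fst q - t0)" for P
      by (metis add.commute diff_add_cancel add_diff_cancel_left')
    then show "q \<in> chron_future A \<beta> \<omega> g0 (t0, x0) \<longleftrightarrow> q \<in> (\<Union>s. {t0 + s} \<times> ball_fwd A \<beta> \<omega> g0 x0 s)"
      by (cases q) (simp add: chron_future_def ball_fwd_def chron_le_iff_fermat_dist[OF som])
  qed
  show "chron_past A \<beta> \<omega> g0 (t0, x0) = (\<Union>s. {t0 - s} \<times> ball_bwd A \<beta> \<omega> g0 x0 s)"
  proof (intro set_eqI)
    fix q :: "real \<times> 'a"
    have "(\<exists>s. fst q = t0 - s \<and> P s) \<longleftrightarrow> P (t0 - fst q)" for P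
      by (metis diff_diff_eq2 add_diff_cancel_left')
    then show "q \<in> chron_past A \<beta> \<omega> g0 (t0, x0) \<longleftrightarrow> q \<in> (\<Union>s. {t0 - s} \<times> ball_bwd A \<beta> \<omega> g0 x0 s)"
      by (cases q) (simp add: chron_past_def ball_bwd_def chron_le_iff_fermat_dist[OF som])
  qed
qed

end
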